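(* Suppose that the standing assumption (i)–(iii) of the context holds, let $\epsilon>0$ be given, and let $\mathcal{U}_\epsilon := \{x\in\mathcal{X} : \operatorname{dist}(0,\partial\Psi(x))>\epsilon\}$. Then the following statements hold. (i) $\partial^{\mathrm C}_{\mathcal X}F^*(x)$ is a singleton for all $x\in\mathcal{U}_\epsilon$, and $F^*$ is differentiable on $\mathcal{U}_\epsilon\cap\operatorname{int}(\mathcal{X})$. (ii) For any $x,x'\in\mathcal{U}_\epsilon\cap\operatorname{int}(\mathcal{X})$ satisfying $\|x-x'\|\le \gamma\epsilon^\sigma/(2L_f)$, $$\|\nabla F^*(x)-\nabla F^*(x')\|\le L_{\nabla f}\|x-x'\|+(1-\theta)^{-1}C^{-1/\theta}L_{\nabla f}^{1/\theta}\,\|x-x'\|^{\frac{1-\theta}{\theta}}.$$ (iii) For any $x,x'\in\mathcal{U}_\epsilon$ satisfying $\|x-x'\|\le\gamma\epsilon^\sigma/(4L_f)$, $$\|\nabla^{\mathrm C}_{\mathcal X}F^*(x)-\nabla^{\mathrm C}_{\mathcal X}F^*(x')\|\le L_{\nabla f}\|x-x'\|+(1-\theta)^{-1}C^{-1/\theta}L_{\nabla f}^{1/\theta}\,\|x-x'\|^{\frac{1-\theta}{\theta}}.$$ (iv) $\nabla^{\mathrm C}_{\mathcal X}F^*(x)=\nabla_x f(x,y^* )$ for all $x\in\mathcal{U}_\epsilon$ and all $y^*\in Y^*(x)$.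
   Context: Problem: $\min_x\max_y\{f(x,y)+p(x)-q(y)\}$, where $f:\mathbb{R}^n\times\mathbb{R}^m\to\mathbb{R}$ is a smooth function, $p:\mathbb{R}^n\to\mathbb{R}\cup\{+\infty\}$, $q:\mathbb{R}^m\to\mathbb{R}\cup\{+\infty\}$. $\|\cdot\|$ is the Euclidean norm. Notation: $\mathcal{X}=\operatorname{dom}p$, $\mathcal{Y}=\operatorname{dom}q$, $F(x,y)=f(x,y)-q(y)$, $F^*(x)=\max_yF(x,y)$, $Y^*(x)=\{y:F(x,y)=F^*(x)\}$, $\Psi(x)=F^*(x)+p(x)$. A function $\phi$ is $L$-Lipschitz on a set if $|\phi(u)-\phi(v)|\le L\|u-v\|$ there, and $L$-smooth on a set if $\|\nabla\phi(u)-\nabla\phi(v)\|\le L\|u-v\|$ there. $\partial$ denotes the limiting subdifferential: for proper closed $\phi$ and $x\in\operatorname{dom}\phi$, $v\in\partial\phi(x)$ iff there are $x^k\to x$ with $\phi(x^k)\to\phi(x)$ and $v^k\to v$ with $\liminf_{z\to x^k,z\ne x^k}\frac{\phi(z)-\phi(x^k)-\langle v^k,z-x^k\rangle}{\|z-x^k\|}\ge0$ for all $k$; it is the usual subdifferential for convex $\phi$. $\partial_yF(x,y)$ means $\nabla_yf(x,y)-\partial q(y)$. $\operatorname{dist}(0,\emptyset)=+\infty$. Standing assumption: (i) For each fixed $y\in\mathcal{Y}$, $f(\cdot,y)$ is $L_f$-Lipschitz continuous on $\mathcal{X}$; moreover $f$ is $L_{\nabla f}$-smooth on $\mathcal{X}\times\mathcal{Y}$.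 (ii) $p$ and $q$ are proper closed convex (with exactly computable proximal operators), and the affine hull of $\mathcal{X}$ is $\mathbb{R}^n$. (iii) For each $x\in\mathcal{X}$, $\max_yF(x,y)$ has a nonempty solution set and finite optimal value, and there are constants $C>0$, $\theta\in[1/2,1)$, $\gamma>0$, $\sigma>0$ such that for any $x\in\mathcal{X}$, $C(F^*(x)-F(x,y))^\theta\le\operatorname{dist}(0,\partial_yF(x,y))$ for all $y\in\mathcal{L}(x)$, where $\mathcal{L}(x)=\{y:0<F^*(x)-F(x,y)\le\gamma\operatorname{dist}(0,\partial\Psi(x))^\sigma\}$. Restricted Clarke subdifferential: for a function $\phi$ locally Lipschitz on $\mathcal{X}$ and $x\in\mathcal{X}$, $\partial^{\mathrm C}_{\mathcal X}\phi(x)=\operatorname{conv}\{v:\exists\,x^k\in\mathcal{X},\ x^k\to x,\ \nabla\phi(x^k)\to v\}$ (the $x^k$ being points where $\phi$ is differentiable). When it is a singleton, its unique element is denoted $\nabla^{\mathrm C}_{\mathcal X}\phi(x)$. *)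

theory Defs
  imports "HOL-Analysis.Analysis"
begin

definition edom :: "('a \<Rightarrow> ereal) \<Rightarrow> 'a set" where
  "edom \<phi> = {x. \<phi> x < \<infinity>}"

definition epi :: "('a \<Rightarrow> ereal) \<Rightarrow> ('a \<times> real) set" where
  "epi \<phi> = {(x, r). \<phi> x \<le> ereal r}"

definition proper_closed_convex :: "('a::euclidean_space \<Rightarrow> ereal) \<Rightarrow> bool" where
  "proper_closed_convex \<phi> \<longleftrightarrow>
     (\<forall>x. \<phi> x \<noteq> -\<infinity>) \<and> edom \<phi> \<noteq> {} \<and> closed (epi \<phi>) \<and> convex (epi \<phi>)"

text \<open>Distance from the origin with the convention \<open>dist(0, \<emptyset>) = +\<infinity>\<close>; the library's
  \<open>infdist\<close> and \<open>setdist\<close> return 0 on the empty set.\<close>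

definition dist0 :: "'a::real_normed_vector set \<Rightarrow> ereal" where
  "dist0 S = (INF v\<in>S. ereal (norm v))"

text \<open>Real power of a nonnegative extended real, for exponents \<open>r > 0\<close>.\<close>

definition epowr :: "ereal \<Rightarrow> real \<Rightarrow> ereal" where
  "epowr a r = (if a = \<infinity> then \<infinity> else ereal (real_of_ereal a powr r))"

definition grad :: "('a::euclidean_space \<Rightarrow> real) \<Rightarrow> 'a \<Rightarrow> 'a" where
  "grad g x = (THE v. GDERIV g x :> v)"

definition smooth_fun :: "('a::euclidean_space \<Rightarrow> real) \<Rightarrow> bool" where
  "smooth_fun g \<longleftrightarrow> (\<forall>x. g differentiable (at x)) \<and> continuous_on UNIV (grad g)"

text \<open>Differentiability of an extended-real-valued function requires finiteness near the point:
  \<open>real_of_ereal\<close> sends infinite values to 0 and alone could create spurious derivatives.\<close>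

definition edifferentiable :: "('a::euclidean_space \<Rightarrow> ereal) \<Rightarrow> 'a \<Rightarrow> bool" where
  "edifferentiable \<phi> x \<longleftrightarrow>
     (\<forall>\<^sub>F z in nhds x. \<bar>\<phi> z\<bar> \<noteq> \<infinity>) \<and> (\<lambda>z. real_of_ereal (\<phi> z)) differentiable (at x)"

definition egrad :: "('a::euclidean_space \<Rightarrow> ereal) \<Rightarrow> 'a \<Rightarrow> 'a" where
  "egrad \<phi> x = grad (\<lambda>z. real_of_ereal (\<phi> z)) x"

definition frechet_subdiff :: "('a::euclidean_space \<Rightarrow> ereal) \<Rightarrow> 'a \<Rightarrow> 'a set" where
  "frechet_subdiff \<phi> x =
     {v. \<bar>\<phi> x\<bar> \<noteq> \<infinity> \<and>
         0 \<le> Liminf (at x) (\<lambda>z. (\<phi> z - \<phi> x - ereal (v \<bullet> (z - x))) / ereal (norm (z - x)))}"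

definition limiting_subdiff :: "('a::euclidean_space \<Rightarrow> ereal) \<Rightarrow> 'a \<Rightarrow> 'a set" where
  "limiting_subdiff \<phi> x =
     {v. \<bar>\<phi> x\<bar> \<noteq> \<infinity> \<and>
         (\<exists>xs vs. xs \<longlonglongrightarrow> x \<and> (\<lambda>k. \<phi> (xs k)) \<longlonglongrightarrow> \<phi> x \<and> vs \<longlonglongrightarrow> v \<and>
                  (\<forall>k. vs k \<in> frechet_subdiff \<phi> (xs k)))}"

definition clarke_subdiff :: "'a::euclidean_space set \<Rightarrow> ('a \<Rightarrow> ereal) \<Rightarrow> 'a \<Rightarrow> 'a set" where
  "clarke_subdiff X \<phi> x =
     convex hull {v. \<exists>xs. (\<forall>k. xs k \<in> X \<and> edifferentiable \<phi> (xs k)) \<and>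
                          xs \<longlonglongrightarrow> x \<and> (\<lambda>k. egrad \<phi> (xs k)) \<longlonglongrightarrow> v}"

text \<open>Meaningful only where the restricted Clarke subdifferential is a singleton.\<close>

definition clarke_grad :: "'a::euclidean_space set \<Rightarrow> ('a \<Rightarrow> ereal) \<Rightarrow> 'a \<Rightarrow> 'a" where
  "clarke_grad X \<phi> x = the_elem (clarke_subdiff X \<phi> x)"

definition Fval :: "('a \<times> 'b \<Rightarrow> real) \<Rightarrow> ('b \<Rightarrow> ereal) \<Rightarrow> 'a \<Rightarrow> 'b \<Rightarrow> ereal" where
  "Fval f q x y = ereal (f (x, y)) - q y"

definition Fstar :: "('a \<times> 'b \<Rightarrow> real) \<Rightarrow> ('b \<Rightarrow> ereal) \<Rightarrow> 'a \<Rightarrow> ereal" where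
  "Fstar f q x = (SUP y. Fval f q x y)"

definition Ystar :: "('a \<times> 'b \<Rightarrow> real) \<Rightarrow> ('b \<Rightarrow> ereal) \<Rightarrow> 'a \<Rightarrow> 'b set" where
  "Ystar f q x = {y. Fval f q x y = Fstar f q x}"

definition Psi :: "('a \<times> 'b \<Rightarrow> real) \<Rightarrow> ('a \<Rightarrow> ereal) \<Rightarrow> ('b \<Rightarrow> ereal) \<Rightarrow> 'a \<Rightarrow> ereal" where
  "Psi f p q x = Fstar f q x + p x"

definition partial_y_F ::
  "('a \<times> 'b::euclidean_space \<Rightarrow> real) \<Rightarrow> ('b \<Rightarrow> ereal) \<Rightarrow> 'a \<Rightarrow> 'b \<Rightarrow> 'b set" where
  "partial_y_F f q x y = {grad (\<lambda>v. f (x, v)) y - u | u. u \<in> limiting_subdiff q y}"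

definition KL_region ::
  "('a::euclidean_space \<times> 'b \<Rightarrow> real) \<Rightarrow> ('a \<Rightarrow> ereal) \<Rightarrow> ('b \<Rightarrow> ereal) \<Rightarrow>
   real \<Rightarrow> real \<Rightarrow> 'a \<Rightarrow> 'b set" where
  "KL_region f p q \<gamma> \<sigma> x =
     {y. 0 < Fstar f q x - Fval f q x y \<and>
         Fstar f q x - Fval f q x y
           \<le> ereal \<gamma> * epowr (dist0 (limiting_subdiff (Psi f p q) x)) \<sigma>}"

definition U_eps ::
  "('a::euclidean_space \<times> 'b \<Rightarrow> real) \<Rightarrow> ('a \<Rightarrow> ereal) \<Rightarrow> ('b \<Rightarrow> ereal) \<Rightarrow> real \<Rightarrow> 'a set" where
  "U_eps f p q \<epsilon> = {x \<in> edom p. ereal \<epsilon> < dist0 (limiting_subdiff (Psi f p q) x)}"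

end

theory Submission
  imports Defs
begin

text \<open>Three ideas carry the proof.

The first is that the Kurdyka-Lojasiewicz inequality makes the solution map Hoelder continuous. If
\<open>x \<in> U\<^sub>\<epsilon>\<close> and \<open>x'\<close> is any point of the domain near \<open>x\<close>, then a maximizer \<open>y'\<close> for \<open>x'\<close>
loses at most \<open>2 L\<^sub>f \<parallel>x - x'\<parallel>\<close> at \<open>x\<close>, so it lies in the region where the inequality holds; and since
\<open>\<nabla>\<^sub>y f(x', y') \<in> \<partial>q(y')\<close>, it is stationary at \<open>x\<close> up to an error \<open>L \<parallel>x - x'\<parallel>\<close>, where \<open>L\<close> is the
Lipschitz constant of \<open>\<nabla>f\<close>. The inequality turns these two facts into a bound of order
\<open>\<parallel>x - x'\<parallel> powr ((1 - \<theta>) / \<theta>)\<close> on the distance of \<open>y'\<close> from the maximizers for \<open>x\<close>: this is the error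
bound \<open>KL_error_bound\<close>, proved by minimizing a power of the suboptimality plus a smoothed distance.
Consequently (\<open>grad_x_near\<close>) the vector
\<open>\<nabla>\<^sub>x f(x', y')\<close> is within the claimed modulus of \<open>\<nabla>\<^sub>x f(x, y)\<close> for some maximizer \<open>y\<close> for \<open>x\<close>.

The second idea removes the word ``some''. At a point \<open>z\<close> where \<open>F\<^sup>*\<close> is differentiable, all
\<open>\<nabla>\<^sub>x f(z, y)\<close> with \<open>y\<close> a maximizer equal the gradient of \<open>F\<^sup>*\<close>, because \<open>F(\<cdot>, y)\<close> touches \<open>F\<^sup>*\<close> from
below. If such \<open>z \<in> U\<^sub>\<epsilon>\<close> accumulate at \<open>x\<close>, the estimate above applied at \<open>z\<close> shows that each
\<open>\<nabla>\<^sub>x f(x, y)\<close> is the limit of the same gradients, so it does not depend on \<open>y\<close> (\<open>grad_x_const\<close>). From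
this everything follows: the modulus holds for all pairs of maximizers (\<open>grad_x_Hoelder\<close>), \<open>F\<^sup>*\<close> is
squeezed between functions with the same first-order expansion at interior points of \<open>U\<^sub>\<epsilon>\<close>
(\<open>Fstar_GDERIV\<close>), and all limits of gradients at \<open>x\<close> coincide (\<open>clarke_subdiff_eq\<close>).

The third idea supplies the points \<open>z\<close>. Density of differentiability points needs no measure theory:
a continuous function is touched from above by a paraboloid somewhere in every ball, and at such a
point \<open>F\<^sup>*\<close>, being a maximum of smooth functions, is also touched from below by a smooth function.
That \<open>z\<close> can be taken in \<open>U\<^sub>\<epsilon>\<close> even when \<open>x\<close> is a boundary point of the domain is outer
semicontinuity of the limiting subdifferential: the condition \<open>dist(0, \<partial>\<Psi>) > \<epsilon>\<close> persists at nearby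
points with nearby values of \<open>\<Psi>\<close>, and \<open>p\<close>, being closed and convex, can be approximated in value
from the interior of its domain.\<close>

section \<open>Gradients and touching functions\<close>

lemma grad_eqI: 
  assumes "GDERIV g x :> v" shows "grad g x = v"
proof -
  have "w = v" if "GDERIV g x :> w" for w
  proof -
    have "(\<lambda>h. h \<bullet> w) = (\<lambda>h. h \<bullet> v)"
      using that assms unfolding gderiv_def by (rule has_derivative_unique)
    then have "(w - v) \<bullet> w = (w - v) \<bullet> v"
      by (rule fun_cong)
    then have "(w - v) \<bullet> (w - v) = 0"
      by (simp add: inner_diff_right)
    then show ?thesis by simp
  qed
  with assms show ?thesis
    unfolding grad_def by blast
qed

lemma GDERIV_grad:
  assumes "g differentiable (at x)" shows "GDERIV g x :> grad g x"
proof -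
  obtain D where D: "(g has_derivative D) (at x)"
    using assms unfolding differentiable_def by blast
  interpret bounded_linear D using D by (rule has_derivative_bounded_linear)
  have "linear D" by unfold_locales
  from adjoint_works[OF this] have "D = (\<lambda>h. h \<bullet> adjoint D 1)"
    by (auto simp: fun_eq_iff)
  with D have "GDERIV g x :> adjoint D 1"
    by (simp add: gderiv_def)
  with grad_eqI[OF this] show ?thesis by simp
qed

lemma GDERIV_differentiable: "GDERIV g x :> v \<Longrightarrow> g differentiable (at x)"
  unfolding gderiv_def differentiable_def by blast

lemma GDERIV_partial:
  fixes f :: "'a::euclidean_space \<times> 'b::euclidean_space \<Rightarrow> real"
  assumes "f differentiable (at (x, y))"
  shows "GDERIV (\<lambda>u. f (u, y)) x :> fst (grad f (x, y))"
    and "GDERIV (\<lambda>v. f (x, v)) y :> snd (grad f (x, y))"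
proof -
  have f: "(f has_derivative (\<lambda>h. h \<bullet> grad f (x, y))) (at (x, y))"
    using GDERIV_grad[OF assms] by (simp add: gderiv_def)
  have "((\<lambda>u. (u, y)) has_derivative (\<lambda>h. (h, 0))) (at x)"
    by (auto intro!: derivative_eq_intros)
  from has_derivative_compose[OF this f]
  show "GDERIV (\<lambda>u. f (u, y)) x :> fst (grad f (x, y))"
    by (simp add: gderiv_def inner_prod_def)
  have "((\<lambda>v. (x, v)) has_derivative (\<lambda>h. (0, h))) (at y)"
    by (auto intro!: derivative_eq_intros)
  from has_derivative_compose[OF this f]
  show "GDERIV (\<lambda>v. f (x, v)) y :> snd (grad f (x, y))"
    by (simp add: gderiv_def inner_prod_def)
qed

lemma GDERIV_square: "GDERIV (\<lambda>w. (norm (w - c))\<^sup>2) z :> 2 *\<^sub>R (z - c)"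
proof -
  have "((\<lambda>w. (w - c) \<bullet> (w - c)) has_derivative (\<lambda>h. 2 * (h \<bullet> (z - c)))) (at z)"
    by (auto intro!: derivative_eq_intros simp: inner_commute algebra_simps)
  then show ?thesis by (simp add: gderiv_def power2_norm_eq_inner)
qed

text \<open>The difference of the two functions has a local minimum at the touching point.\<close>

lemma GDERIV_eq_if_touching:
  assumes "GDERIV g x :> v" "GDERIV h x :> w" "g x = h x"
    and "\<forall>\<^sub>F z in nhds x. g z \<le> h z"
  shows "v = w"
proof -
  have "((\<lambda>z. h z - g z) has_derivative (\<lambda>u. u \<bullet> w - u \<bullet> v)) (at x)"
    using assms(1,2) unfolding gderiv_def by (intro has_derivative_diff)
  moreover have "\<forall>\<^sub>F z in at x. h x - g x \<le> h z - g z"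
    using assms(3) eventually_nhds_conv_at assms(4) by fastforce
  ultimately have "(\<lambda>u. u \<bullet> w - u \<bullet> v) = (\<lambda>u. 0)"
    by (rule has_derivative_local_min)
  then have "(v - w) \<bullet> w - (v - w) \<bullet> v = 0"
    by (rule fun_cong)
  then have "(v - w) \<bullet> (v - w) = 0"
    by (simp add: inner_diff_right)
  then show ?thesis by simp
qed

lemma GDERIV_iff_error_bound:
  "GDERIV g x :> v \<longleftrightarrow>
    (\<forall>e>0. \<exists>d>0. \<forall>z. norm (z - x) < d \<longrightarrow> \<bar>g z - g x - (z - x) \<bullet> v\<bar> \<le> e * norm (z - x))"
  unfolding gderiv_def has_derivative_at_alt 
  by (auto simp: bounded_linear_inner_left)

lemma GDERIV_sandwich:
  assumes l: "GDERIV l x :> v" and u: "GDERIV u x :> v" and eq: "l x = g x" "u x = g x"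
    and lg: "\<forall>\<^sub>F z in nhds x. l z \<le> g z" and gu: "\<forall>\<^sub>F z in nhds x. g z \<le> u z"
  shows "GDERIV g x :> v"
  unfolding GDERIV_iff_error_bound
proof (intro allI impI)
  fix e :: real assume "0 < e"
  obtain d1 where d1: "d1 > 0" "\<And>z. norm (z - x) < d1 \<Longrightarrow> \<bar>l z - l x - (z - x) \<bullet> v\<bar> \<le> e * norm (z - x)"
    using l \<open>0 < e\<close> unfolding GDERIV_iff_error_bound by blast
  obtain d2 where d2: "d2 > 0" "\<And>z. norm (z - x) < d2 \<Longrightarrow> \<bar>u z - u x - (z - x) \<bullet> v\<bar> \<le> e * norm (z - x)"
    using u \<open>0 < e\<close> unfolding GDERIV_iff_error_bound by blast
  obtain d3 where d3: "d3 > 0" "\<And>z. norm (z - x) < d3 \<Longrightarrow> l z \<le> g z"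
    using lg unfolding eventually_nhds_metric dist_norm by blast
  obtain d4 where d4: "d4 > 0" "\<And>z. norm (z - x) < d4 \<Longrightarrow> g z \<le> u z"
    using gu unfolding eventually_nhds_metric dist_norm by blast
  have "\<bar>g z - g x - (z - x) \<bullet> v\<bar> \<le> e * norm (z - x)"
    if "norm (z - x) < min (min d1 d2) (min d3 d4)" for z
    using d1(2)[of z] d2(2)[of z] d3(2)[of z] d4(2)[of z] that eq by (auto simp: abs_le_iff)
  moreover have "min (min d1 d2) (min d3 d4) > 0"
    using d1 d2 d3 d4 by simp
  ultimately show "\<exists>d>0. \<forall>z. norm (z - x) < d \<longrightarrow> \<bar>g z - g x - (z - x) \<bullet> v\<bar> \<le> e * norm (z - x)"
    by blast
qed

section \<open>Frechet and limiting subgradients\<close>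

text \<open>All subgradients of \<open>q\<close> below are produced this way, by a smooth function touching from below up to
a constant.\<close>

lemma frechet_subdiffI:
  assumes fin: "\<bar>\<phi> x\<bar> \<noteq> \<infinity>" and g: "GDERIV g x :> v"
    and below: "\<forall>\<^sub>F z in nhds x. \<phi> x + ereal (g z - g x) \<le> \<phi> z"
  shows "v \<in> frechet_subdiff \<phi> x"
proof -
  obtain c where c: "\<phi> x = ereal c" using fin by (cases "\<phi> x") auto
  obtain d0 where d0: "d0 > 0" "\<And>z. norm (z - x) < d0 \<Longrightarrow> \<phi> x + ereal (g z - g x) \<le> \<phi> z"
    using below unfolding eventually_nhds_metric dist_norm by blast
  have "\<forall>\<^sub>F z in at x. a < (\<phi> z - \<phi> x - ereal (v \<bullet> (z - x))) / ereal (norm (z - x))"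
    if a0: "a < 0" for a :: ereal
  proof -
    obtain b where b: "a < ereal b" "ereal b < 0"
      using ereal_dense2[OF a0] by blast
    then have "- b > 0" by simp
    then obtain d1 where d1: "d1 > 0"
      "\<And>z. norm (z - x) < d1 \<Longrightarrow> \<bar>g z - g x - (z - x) \<bullet> v\<bar> \<le> - b * norm (z - x)"
      using g unfolding GDERIV_iff_error_bound by blast
    have "a < (\<phi> z - \<phi> x - ereal (v \<bullet> (z - x))) / ereal (norm (z - x))"
      if z: "z \<noteq> x" "dist z x < min d0 d1" for z
    proof -
      have n: "norm (z - x) > 0" using z by simp
      have "- (- b * norm (z - x)) \<le> g z - g x - v \<bullet> (z - x)"
        using d1(2)[of z] z by (simp add: dist_norm abs_le_iff inner_commute)
      then have bn: "b * norm (z - x) \<le> g z - g x - v \<bullet> (z - x)" by simp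
      have le: "ereal (c + (g z - g x)) \<le> \<phi> z"
        using d0(2)[of z] z c by (simp add: dist_norm)
      have "ereal b \<le> (\<phi> z - \<phi> x - ereal (v \<bullet> (z - x))) / ereal (norm (z - x))"
      proof (cases "\<phi> z")
        case (real r)
        then have "b * norm (z - x) \<le> r - c - v \<bullet> (z - x)"
          using le bn by simp
        then have "b \<le> (r - c - v \<bullet> (z - x)) / norm (z - x)"
          using n by (simp add: pos_le_divide_eq)
        then show ?thesis using real c n by simp
      qed (use le c n in auto)
      with b(1) show ?thesis by (rule less_le_trans)
    qed
    then show ?thesis
      unfolding eventually_at using d0 d1 by (intro exI[of _ "min d0 d1"]) auto
  qed
  then have "0 \<le> Liminf (at x) (\<lambda>z. (\<phi> z - \<phi> x - ereal (v \<bullet> (z - x))) / ereal (norm (z - x)))"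
    unfolding le_Liminf_iff by blast
  with fin show ?thesis by (simp add: frechet_subdiff_def)
qed

lemma frechet_subset_limiting: "frechet_subdiff \<phi> x \<subseteq> limiting_subdiff \<phi> x"
proof
  fix v assume v: "v \<in> frechet_subdiff \<phi> x"
  then have "\<bar>\<phi> x\<bar> \<noteq> \<infinity>" by (simp add: frechet_subdiff_def)
  moreover have "(\<lambda>_::nat. x) \<longlonglongrightarrow> x" "(\<lambda>_::nat. v) \<longlonglongrightarrow> v" "(\<lambda>_::nat. \<phi> x) \<longlonglongrightarrow> \<phi> x" by auto
  ultimately show "v \<in> limiting_subdiff \<phi> x"
    using v unfolding limiting_subdiff_def by blast
qed

text \<open>A diagonal argument built into one equivalence: limiting subgradients of norm at most \<open>e\<close> exist
iff there are Frechet subgradients of norm almost \<open>e\<close> at points arbitrarily close in position and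
in value. Small Frechet subgradients are bounded, so a subsequence converges. The right-hand side
has no limits in it, which makes stability under perturbation of \<open>x\<close> a triangle inequality.\<close>

lemma dist0_limiting_le_iff:
  fixes \<phi> :: "'a::euclidean_space \<Rightarrow> ereal"
  assumes fin: "\<bar>\<phi> x\<bar> \<noteq> \<infinity>"
  shows "dist0 (limiting_subdiff \<phi> x) \<le> ereal e \<longleftrightarrow>
    (\<forall>d>0. \<exists>z w. dist z x < d \<and> \<bar>\<phi> z - \<phi> x\<bar> < ereal d \<and> w \<in> frechet_subdiff \<phi> z \<and> norm w < e + d)"
    (is "?L \<longleftrightarrow> ?R")
proof
  obtain c where c: "\<phi> x = ereal c" using fin by (cases "\<phi> x") auto
  {
    assume L: ?L
    show ?R
    proof (intro allI impI)
      fix d :: real assume d: "0 < d"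
      have "dist0 (limiting_subdiff \<phi> x) < ereal (e + d)"
        using L d by (intro le_less_trans[OF L]) simp
      then obtain v where v: "v \<in> limiting_subdiff \<phi> x" "norm v < e + d"
        unfolding dist0_def INF_less_iff by auto
      then obtain xs vs where xs: "xs \<longlonglongrightarrow> x" "(\<lambda>k. \<phi> (xs k)) \<longlonglongrightarrow> \<phi> x" "vs \<longlonglongrightarrow> v"
        "\<And>k. vs k \<in> frechet_subdiff \<phi> (xs k)"
        unfolding limiting_subdiff_def by blast
      have "\<forall>\<^sub>F k in sequentially. dist (xs k) x < d"
        using xs(1) d by (rule tendstoD)
      moreover have "\<forall>\<^sub>F k in sequentially. norm (vs k) < e + d"
        using tendsto_norm[OF xs(3)] v(2) by (rule order_tendstoD)
      moreover have "\<forall>\<^sub>F k in sequentially. ereal (c - d) < \<phi> (xs k)"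
        using xs(2) c d by (intro order_tendstoD) auto
      moreover have "\<forall>\<^sub>F k in sequentially. \<phi> (xs k) < ereal (c + d)"
        using xs(2) c d by (intro order_tendstoD) auto
      ultimately have "\<forall>\<^sub>F k in sequentially. dist (xs k) x < d \<and> \<bar>\<phi> (xs k) - \<phi> x\<bar> < ereal d
          \<and> norm (vs k) < e + d"
      proof eventually_elim
        case (elim k)
        then show ?case using c by (cases "\<phi> (xs k)") (auto simp: abs_less_iff)
      qed
      then obtain k where "dist (xs k) x < d \<and> \<bar>\<phi> (xs k) - \<phi> x\<bar> < ereal d \<and> norm (vs k) < e + d"
        using eventually_happens trivial_limit_sequentially by blast
      with xs(4)[of k] show "\<exists>z w. dist z x < d \<and> \<bar>\<phi> z - \<phi> x\<bar> < ereal d \<and> w \<in> frechet_subdiff \<phi> z \<and> norm w < e + d"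
        by blast
    qed
  next
    assume R: ?R
    define dd where "dd k = 1 / real (Suc k)" for k
    have dd0: "dd k > 0" for k by (simp add: dd_def)
    have "\<forall>k. \<exists>zw. dist (fst zw) x < dd k \<and> \<bar>\<phi> (fst zw) - \<phi> x\<bar> < ereal (dd k)
        \<and> snd zw \<in> frechet_subdiff \<phi> (fst zw) \<and> norm (snd zw) < e + dd k"
    proof
      fix k
      obtain z w where "dist z x < dd k \<and> \<bar>\<phi> z - \<phi> x\<bar> < ereal (dd k) \<and> w \<in> frechet_subdiff \<phi> z \<and> norm w < e + dd k"
        using R dd0[of k] by blast
      then show "\<exists>zw. dist (fst zw) x < dd k \<and> \<bar>\<phi> (fst zw) - \<phi> x\<bar> < ereal (dd k)
        \<and> snd zw \<in> frechet_subdiff \<phi> (fst zw) \<and> norm (snd zw) < e + dd k"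
        by (intro exI[of _ "(z, w)"]) simp
    qed
    then obtain zw where zw: "\<And>k. dist (fst (zw k)) x < dd k \<and> \<bar>\<phi> (fst (zw k)) - \<phi> x\<bar> < ereal (dd k)
        \<and> snd (zw k) \<in> frechet_subdiff \<phi> (fst (zw k)) \<and> norm (snd (zw k)) < e + dd k"
      by metis
    define z w where "z k = fst (zw k)" and "w k = snd (zw k)" for k
    have z: "dist (z k) x < dd k" "\<bar>\<phi> (z k) - \<phi> x\<bar> < ereal (dd k)"
      and w: "w k \<in> frechet_subdiff \<phi> (z k)" "norm (w k) < e + dd k" for k
      using zw by (auto simp: z_def w_def)
    have dd: "dd \<longlonglongrightarrow> 0"
      unfolding dd_def using lim_inverse_n' LIMSEQ_Suc by fastforce
    have zx: "z \<longlonglongrightarrow> x"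
      by (rule metric_tendsto_imp_tendsto[OF dd], rule always_eventually, rule allI)
        (use z(1) in \<open>simp add: dist_real_def less_imp_le dd0\<close>)
    have dd1: "dd k \<le> 1" for k by (simp add: dd_def)
    have "norm (w k) \<le> e + 1" for k using w(2)[of k] dd1[of k] by linarith
    then have "bounded (range w)" by (auto simp: bounded_iff)
    then obtain v r where r: "strict_mono r" "(w \<circ> r) \<longlonglongrightarrow> v"
      using bounded_imp_convergent_subsequence by blast
    have "\<phi> (z k) = ereal (real_of_ereal (\<phi> (z k)))" for k
      using w(1)[of k] by (simp add: frechet_subdiff_def ereal_real)
    then have eq: "(\<lambda>k. \<phi> (z k)) = (\<lambda>k. ereal (real_of_ereal (\<phi> (z k))))"
      by (rule ext)
    have "(\<lambda>k. real_of_ereal (\<phi> (z k))) \<longlonglongrightarrow> c"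
    proof (rule metric_tendsto_imp_tendsto[OF dd], rule always_eventually, rule allI)
      fix k
      show "dist (real_of_ereal (\<phi> (z k))) c \<le> dist (dd k) 0"
        using z(2)[of k] c w(1)[of k] dd0[of k]
        by (cases "\<phi> (z k)") (auto simp: frechet_subdiff_def dist_norm)
    qed
    then have phi: "(\<lambda>k. \<phi> (z k)) \<longlonglongrightarrow> \<phi> x"
      unfolding c by (subst eq) (rule tendsto_ereal)
    have "v \<in> limiting_subdiff \<phi> x"
      unfolding limiting_subdiff_def mem_Collect_eq
      by (rule conjI[OF fin], rule exI[of _ "z \<circ> r"], rule exI[of _ "w \<circ> r"])
        (use LIMSEQ_subseq_LIMSEQ[OF zx r(1)] LIMSEQ_subseq_LIMSEQ[OF phi r(1)] r(2) w(1)
          in \<open>simp add: o_def\<close>)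
    moreover have "norm v \<le> e"
    proof (rule LIMSEQ_le)
      show "(\<lambda>k. norm ((w \<circ> r) k)) \<longlonglongrightarrow> norm v" using r(2) by (rule tendsto_norm)
      have "(\<lambda>k. e + (dd \<circ> r) k) \<longlonglongrightarrow> e + 0"
        by (intro tendsto_add tendsto_const LIMSEQ_subseq_LIMSEQ[OF dd r(1)])
      then show "(\<lambda>k. e + (dd \<circ> r) k) \<longlonglongrightarrow> e" by simp
      show "\<exists>N. \<forall>n\<ge>N. norm ((w \<circ> r) n) \<le> e + (dd \<circ> r) n"
        using w(2) less_imp_le by (auto simp: o_def)
    qed
    ultimately show ?L
      unfolding dist0_def by (intro INF_lower2[of v]) auto
  }
qed

text \<open>Outer semicontinuity of the limiting subdifferential, in the form in which it keeps points
inside \<open>U\<^sub>\<epsilon>\<close>. Closeness of the values cannot be dropped, since \<open>\<phi>\<close> may jump.\<close>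

lemma dist0_limiting_gt_nearby:
  fixes \<phi> :: "'a::euclidean_space \<Rightarrow> ereal"
  assumes fin: "\<bar>\<phi> x\<bar> \<noteq> \<infinity>" and gt: "ereal e < dist0 (limiting_subdiff \<phi> x)"
  shows "\<exists>d>0. \<forall>z. dist z x < d \<longrightarrow> \<bar>\<phi> z - \<phi> x\<bar> < ereal d \<longrightarrow> ereal e < dist0 (limiting_subdiff \<phi> z)"
proof -
  obtain c where c: "\<phi> x = ereal c" using fin by (cases "\<phi> x") auto
  obtain d where d: "d > 0"
    and none: "\<And>z w. dist z x < d \<Longrightarrow> \<bar>\<phi> z - \<phi> x\<bar> < ereal d \<Longrightarrow> w \<in> frechet_subdiff \<phi> z \<Longrightarrow> \<not> norm w < e + d"
    using gt dist0_limiting_le_iff[where \<phi> = \<phi>, OF fin, of e] unfolding not_le[symmetric] by blast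
  have "ereal e < dist0 (limiting_subdiff \<phi> z)"
    if z: "dist z x < d / 2" "\<bar>\<phi> z - \<phi> x\<bar> < ereal (d / 2)" for z
  proof (rule ccontr)
    assume "\<not> ?thesis"
    then have le: "dist0 (limiting_subdiff \<phi> z) \<le> ereal e" by simp
    obtain b where b: "\<phi> z = ereal b" using z c by (cases "\<phi> z") auto
    then have "\<bar>\<phi> z\<bar> \<noteq> \<infinity>" by simp
    from dist0_limiting_le_iff[where \<phi> = \<phi>, OF this, of e] le d obtain z' w
      where w: "dist z' z < d / 2" "\<bar>\<phi> z' - \<phi> z\<bar> < ereal (d / 2)" "w \<in> frechet_subdiff \<phi> z'" "norm w < e + d / 2"
      by (meson half_gt_zero)
    have "dist z' x < d" using dist_triangle[of z' x z] w(1) z(1) by simp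
    moreover have "\<bar>\<phi> z' - \<phi> x\<bar> < ereal d"
    proof (cases "\<phi> z'")
      case (real r)
      then have "\<bar>r - b\<bar> < d / 2" "\<bar>b - c\<bar> < d / 2" using z(2) w(2) b c by auto
      then have "\<bar>r - c\<bar> < d" by arith
      then show ?thesis using real c by simp
    qed (use w(2) b in auto)
    ultimately show False using none w d by fastforce
  qed
  then show ?thesis using d by (intro exI[of _ "d / 2"]) auto
qed

section \<open>Closed convex functions near their domain boundary\<close>

lemma proper_closed_convex_real:
  assumes "proper_closed_convex p" "x \<in> edom p"
  shows "p x = ereal (real_of_ereal (p x))"
  using assms by (cases "p x") (auto simp: proper_closed_convex_def edom_def)

lemma proper_closed_convex_convex_on:
  assumes p: "proper_closed_convex p"
  shows "convex_on (edom p) (\<lambda>x. real_of_ereal (p x))"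
proof -
  have *: "p (u *\<^sub>R x + v *\<^sub>R y) \<le> ereal (u * real_of_ereal (p x) + v * real_of_ereal (p y))"
    if "x \<in> edom p" "y \<in> edom p" "0 \<le> u" "0 \<le> v" "u + v = 1" for x y u v
  proof -
    have "(x, real_of_ereal (p x)) \<in> epi p" "(y, real_of_ereal (p y)) \<in> epi p"
      using proper_closed_convex_real[OF p] that by (auto simp: epi_def)
    then have "u *\<^sub>R (x, real_of_ereal (p x)) + v *\<^sub>R (y, real_of_ereal (p y)) \<in> epi p"
      using p that unfolding proper_closed_convex_def convex_def by blast
    then show ?thesis by (simp add: epi_def)
  qed
  have cvx: "convex (edom p)"
    unfolding convex_def
  proof (intro ballI allI impI)
    fix x y u v assume a: "x \<in> edom p" "y \<in> edom p" "(0::real) \<le> u" "0 \<le> v" "u + v = 1"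
    show "u *\<^sub>R x + v *\<^sub>R y \<in> edom p" using *[OF a] by (auto simp: edom_def)
  qed
  show ?thesis
    unfolding convex_on_def
  proof (intro conjI ballI allI impI cvx)
    fix x y u v assume a: "x \<in> edom p" "y \<in> edom p" "(0::real) \<le> u" "0 \<le> v" "u + v = 1"
    then have "u *\<^sub>R x + v *\<^sub>R y \<in> edom p" using cvx unfolding convex_def by blast
    then have "p (u *\<^sub>R x + v *\<^sub>R y) = ereal (real_of_ereal (p (u *\<^sub>R x + v *\<^sub>R y)))"
      by (rule proper_closed_convex_real[OF p])
    then obtain r where "p (u *\<^sub>R x + v *\<^sub>R y) = ereal r" by blast
    with *[OF a] show "real_of_ereal (p (u *\<^sub>R x + v *\<^sub>R y)) \<le> u * real_of_ereal (p x) + v * real_of_ereal (p y)"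
      by simp
  qed
qed

text \<open>Along the segment from \<open>x\<close> to an interior point, convexity bounds \<open>p\<close> from above by values
tending to \<open>p x\<close>, and closedness of the epigraph bounds it from below.\<close>

lemma proper_closed_convex_interior_approx:
  fixes p :: "'a::euclidean_space \<Rightarrow> ereal"
  assumes p: "proper_closed_convex p" and aff: "affine hull (edom p) = UNIV"
    and x: "x \<in> edom p" and d: "d > 0"
  shows "\<exists>z \<in> interior (edom p). dist z x < d \<and> \<bar>real_of_ereal (p z) - real_of_ereal (p x)\<bar> < d"
proof -
  let ?P = "\<lambda>x. real_of_ereal (p x)"
  note con = proper_closed_convex_convex_on[OF p]
  then have cvx: "convex (edom p)" by (simp add: convex_on_def)
  have "interior (edom p) \<noteq> {}"
    using rel_interior_interior[OF aff] rel_interior_eq_empty[OF cvx] x by auto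
  then obtain c where c: "c \<in> interior (edom p)" by blast
  then have c': "c \<in> edom p" using interior_subset by blast
  define xs where "xs t = x - t *\<^sub>R (x - c)" for t
  have lim: "(xs \<longlongrightarrow> x) (at_right 0)"
    unfolding xs_def by (auto intro!: tendsto_eq_intros)
  have int: "xs t \<in> interior (edom p)" if "0 < t" "t \<le> 1" for t
    unfolding xs_def using mem_interior_convex_shrink[OF cvx c x that] .
  have up: "?P (xs t) \<le> ?P x + t * (?P c - ?P x)" if "0 < t" "t \<le> 1" for t
    using convex_onD[OF con, of t x c] that x c' by (simp add: xs_def algebra_simps)
  have t1: "\<forall>\<^sub>F t in at_right 0. t \<le> (1::real)" 
    unfolding eventually_at_right[OF zero_less_one] by (intro exI[of _ 1]) auto
  have t0: "\<forall>\<^sub>F t in at_right 0. 0 < (t::real)"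
    by (rule eventually_at_right_less)
  have "(\<lambda>t. ?P x + t * (?P c - ?P x)) \<midarrow>0\<rightarrow> ?P x"
    by (auto intro!: tendsto_eq_intros)
  then have "((\<lambda>t. ?P x + t * (?P c - ?P x)) \<longlongrightarrow> ?P x) (at_right 0)"
    by (rule filterlim_mono) (auto simp: at_within_le_at)
  then have ub: "\<forall>\<^sub>F t in at_right 0. ?P x + t * (?P c - ?P x) < ?P x + d"
    using d by (intro order_tendstoD) auto
  have below: "?P z > s" if "z \<in> edom p" "(z, s) \<notin> epi p" for z s
  proof -
    note z = that
    obtain r where "p z = ereal r" using proper_closed_convex_real[OF p z(1)] by blast
    with z(2) show ?thesis by (simp add: epi_def not_le)
  qed
  have "(x, ?P x - d) \<notin> epi p"
  proof -
    obtain r where "p x = ereal r" using proper_closed_convex_real[OF p x] by blast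
    with d show ?thesis by (simp add: epi_def)
  qed
  moreover have "open (- epi p)" using p by (simp add: proper_closed_convex_def open_Compl)
  moreover have "((\<lambda>t. (xs t, ?P x - d)) \<longlongrightarrow> (x, ?P x - d)) (at_right 0)"
    by (intro tendsto_Pair lim tendsto_const)
  ultimately have lb: "\<forall>\<^sub>F t in at_right 0. (xs t, ?P x - d) \<in> - epi p"
    by (intro topological_tendstoD) auto
  have "\<forall>\<^sub>F t in at_right 0. dist (xs t) x < d"
    using lim d by (rule tendstoD)
  with t0 t1 ub lb have "\<forall>\<^sub>F t in at_right (0::real). xs t \<in> interior (edom p) \<and> dist (xs t) x < d
     \<and> \<bar>?P (xs t) - ?P x\<bar> < d"
  proof eventually_elim
    case (elim t)
    have i: "xs t \<in> interior (edom p)" using int elim by simp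
    then have "xs t \<in> edom p" using interior_subset by blast
    with below[OF this] elim(4) have "?P x - d < ?P (xs t)" by simp
    moreover have "?P (xs t) < ?P x + d" using up[of t] elim by simp
    ultimately show ?case using i elim by (simp add: abs_less_iff)
  qed
  then show ?thesis
    using eventually_happens'[OF trivial_limit_at_right_real] by blast
qed

section \<open>Touching a continuous function from above\<close>

text \<open>A steep enough paraboloid centred at \<open>c\<close> pushes the maximum of \<open>g - M \<parallel>\<cdot> - c\<parallel>\<^sup>2\<close> off the
sphere of radius \<open>r\<close>.\<close>

lemma touched_by_paraboloid:
  fixes g :: "'a::euclidean_space \<Rightarrow> real"
  assumes cont: "continuous_on (cball c r) g" and r: "r > 0"
  shows "\<exists>z \<in> ball c r. \<exists>M. \<forall>w \<in> ball c r. g w \<le> g z + M * ((norm (w - c))\<^sup>2 - (norm (z - c))\<^sup>2)"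
proof -
  have ne: "cball c r \<noteq> {}" using r by simp
  obtain b where b: "\<And>w. w \<in> cball c r \<Longrightarrow> g w \<le> g b"
    using continuous_attains_sup[OF compact_cball ne cont] by blast
  define M where "M = (g b - g c + 1) / r\<^sup>2"
  have "continuous_on (cball c r) (\<lambda>w. g w - M * (norm (w - c))\<^sup>2)"
    by (intro continuous_intros cont)
  from continuous_attains_sup[OF compact_cball ne this]
  obtain z where z: "z \<in> cball c r"
    and max: "\<And>w. w \<in> cball c r \<Longrightarrow> g w - M * (norm (w - c))\<^sup>2 \<le> g z - M * (norm (z - c))\<^sup>2"
    by blast
  have "norm (z - c) \<noteq> r"
  proof
    assume "norm (z - c) = r"
    then have "g z - M * (norm (z - c))\<^sup>2 < g c"
      using r b[OF z] by (simp add: M_def)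
    with max[of c] r show False by simp
  qed
  with z have "z \<in> ball c r" by (simp add: dist_norm norm_minus_commute)
  moreover have "g w \<le> g z + M * ((norm (w - c))\<^sup>2 - (norm (z - c))\<^sup>2)" if "w \<in> ball c r" for w
    using max[of w] that by (simp add: algebra_simps)
  ultimately show ?thesis by blast
qed

section \<open>The error bound from the Kurdyka-Lojasiewicz inequality\<close>

text \<open>Here \<open>E\<close> measures how far \<open>g - q\<close> is below the level \<open>a\<close>, an upper bound for it. Minimize
\<open>E powr (1 - \<theta>) / (1 - \<theta>) + C' N\<close> with \<open>C' < C\<close> and \<open>N\<close> a smoothed distance from \<open>y\<close>. If \<open>E > 0\<close>
at the minimizer \<open>z\<close>, the optimality condition yields a subgradient \<open>u\<close> of \<open>q\<close> with
\<open>\<parallel>\<nabla>g z - u\<parallel> \<le> C' E z powr \<theta>\<close>, which the inequality with the constant \<open>C\<close> forbids; hence \<open>E z = 0\<close>,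
and comparison with \<open>y\<close> bounds the distance. Smoothing makes \<open>N\<close> differentiable also at \<open>y\<close>, so that
\<open>u\<close> arises directly as a Frechet subgradient and no sum rule for subdifferentials is involved.\<close>

lemma KL_error_bound:
  fixes g :: "'b::euclidean_space \<Rightarrow> real" and q :: "'b \<Rightarrow> ereal" and a :: real
  defines "E \<equiv> \<lambda>z. a - g z + real_of_ereal (q z)"
  assumes closed: "closed (epi q)" and q: "\<And>z. q z \<noteq> -\<infinity>"
    and g: "\<And>z. g differentiable (at z)"
    and E0: "\<And>z. z \<in> edom q \<Longrightarrow> 0 \<le> E z"
    and const: "0 < C" "0 < \<theta>" "\<theta> < 1"
    and KL: "\<And>z u. z \<in> edom q \<Longrightarrow> 0 < E z \<Longrightarrow> E z \<le> E y \<Longrightarrow> u \<in> frechet_subdiff q z \<Longrightarrow>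
               C * E z powr \<theta> \<le> norm (grad g z - u)"
    and y: "y \<in> edom q"
    and \<eta>: "E y powr (1 - \<theta>) / ((1 - \<theta>) * C) < \<eta>"
  shows "\<exists>z \<in> edom q. E z = 0 \<and> norm (z - y) \<le> \<eta>"
proof -
  define s where "s = 1 - \<theta>"
  have s: "0 < s" "s < 1" "s + \<theta> = 1" using const by (auto simp: s_def)
  define e where "e = E y powr s / s"
  have e0: "e \<ge> 0" using s by (simp add: e_def)
  have eC: "e / C < \<eta>" using \<eta> by (simp add: e_def s_def)
  \<comment> \<open>The slack in the strict bound is split between \<open>C'\<close> just below \<open>C\<close> and the smoothing parameter \<open>\<delta>\<close>.\<close>
  have eC0: "0 \<le> e / C" using e0 const by simp
  have \<eta>0: "\<eta> > 0" using eC0 eC by (rule le_less_trans)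
  obtain m where m: "e / C < m" "m < \<eta>" using dense[OF eC] by blast
  have m0: "m > 0" using eC0 m(1) by (rule le_less_trans)
  have "e / m < C" using m(1) m0 const by (simp add: field_simps)
  then obtain C' where C': "e / m < C'" "C' < C" using dense by blast
  have C'0: "C' > 0" using e0 m0 C'(1) by (intro le_less_trans[OF _ C'(1)]) simp
  have em: "e \<le> C' * m" using C'(1) m0 by (simp add: field_simps)
  define \<delta> where "\<delta> = \<eta> - m"
  have \<delta>: "\<delta> > 0" using m(2) by (simp add: \<delta>_def)
  define N where "N z = sqrt (\<delta>\<^sup>2 + (norm (z - y))\<^sup>2)" for z
  have N_pos: "N z > 0" for z using \<delta> by (simp add: N_def add_pos_nonneg)
  have N_ge: "norm (z - y) \<le> N z" "\<delta> \<le> N z" for z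
    unfolding N_def using \<delta> by (auto intro!: real_le_rsqrt)
  have N_y: "N y = \<delta>" using \<delta> by (simp add: N_def)
  have q_real: "q z = ereal (real_of_ereal (q z))" if "z \<in> edom q" for z
    using that q[of z] by (cases "q z") (auto simp: edom_def)
  have g_cont: "continuous_on S g" for S
    using g by (meson continuous_at_imp_continuous_on differentiable_imp_continuous_within)

  \<comment> \<open>Minimizing over the epigraph of \<open>q\<close> replaces a semicontinuous function by a continuous one on a compact set.\<close>
  define T where "T = epi q \<inter> {(z, r). z \<in> cball y (\<eta> + 1) \<and> r \<le> E y - a + g z}"
  obtain G where G: "\<And>z. z \<in> cball y (\<eta> + 1) \<Longrightarrow> \<bar>g z\<bar> \<le> G"
  proof -
    have "bounded (g ` cball y (\<eta> + 1))"
      by (intro compact_imp_bounded compact_continuous_image g_cont compact_cball)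
    then show ?thesis using that unfolding bounded_iff by fastforce
  qed
  have T_dom: "z \<in> edom q" "real_of_ereal (q z) \<le> r" if "(z, r) \<in> T" for z r
  proof -
    have le: "q z \<le> ereal r" using that by (simp add: T_def epi_def)
    then show "z \<in> edom q" by (auto simp: edom_def)
    then obtain t where "q z = ereal t" using q_real by blast
    with le show "real_of_ereal (q z) \<le> r" by simp
  qed
  have "T \<subseteq> cball y (\<eta> + 1) \<times> {- a - G .. E y - a + G}"
  proof safe
    fix z r assume zr: "(z, r) \<in> T"
    show z: "z \<in> cball y (\<eta> + 1)" using zr by (simp add: T_def)
    have "r \<le> E y - a + g z" using zr by (simp add: T_def)
    moreover have "- a + g z \<le> r" using E0[OF T_dom(1)[OF zr]] T_dom(2)[OF zr] by (simp add: E_def)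
    ultimately show "r \<in> {- a - G .. E y - a + G}" using G[OF z] by auto
  qed
  then have "bounded T"
    by (rule bounded_subset[rotated]) (intro compact_imp_bounded compact_Times compact_cball compact_Icc)
  moreover have "closed T"
  proof -
    have "T = epi q \<inter> ((\<lambda>zr. fst zr) -` cball y (\<eta> + 1) \<inter> {zr. snd zr \<le> E y - a + g (fst zr)})"
      by (auto simp: T_def)
    moreover have "closed {zr :: 'b \<times> real. snd zr \<le> E y - a + g (fst zr)}"
      by (intro closed_Collect_le continuous_intros continuous_on_compose2[OF g_cont[of UNIV]]) auto
    ultimately show ?thesis
      using closed by (auto intro!: closed_Int closed_vimage_fst)
  qed
  ultimately have "compact T" by (simp add: compact_eq_bounded_closed)
  moreover have yT: "(y, real_of_ereal (q y)) \<in> T"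
    using q_real[OF y] \<eta>0 by (simp add: T_def epi_def E_def)
  moreover have "continuous_on T (\<lambda>zr. (a - g (fst zr) + snd zr) powr s / s + C' * N (fst zr))"
  proof -
    have "0 \<le> a - g z + r" if "(z, r) \<in> T" for z r
      using E0[OF T_dom(1)[OF that]] T_dom(2)[OF that] by (simp add: E_def)
    then show ?thesis
      unfolding N_def using s
      by (intro continuous_intros continuous_on_powr' continuous_on_compose2[OF g_cont[of UNIV]]) auto
  qed
  ultimately obtain z r where zr: "(z, r) \<in> T" and min: "\<And>w t. (w, t) \<in> T \<Longrightarrow>
      (a - g z + r) powr s / s + C' * N z \<le> (a - g w + t) powr s / s + C' * N w"
    using continuous_attains_inf[of T "\<lambda>zr. (a - g (fst zr) + snd zr) powr s / s + C' * N (fst zr)"]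
    by fastforce
  have z: "z \<in> edom q" using T_dom[OF zr] by simp
  have minE: "E z powr s / s + C' * N z \<le> (a - g w + t) powr s / s + C' * N w" if "(w, t) \<in> T" for w t
  proof -
    have "E z powr s / s \<le> (a - g z + r) powr s / s"
      using s E0[OF z] T_dom[OF zr] by (intro divide_right_mono powr_mono2) (auto simp: E_def)
    with min[OF that] show ?thesis by simp
  qed
  have min_y: "E z powr s / s + C' * N z \<le> e + C' * \<delta>"
    using minE[OF yT] by (simp add: E_def e_def N_y)
  \<comment> \<open>Off the level set of \<open>E y\<close> the objective already exceeds its value at \<open>y\<close>.\<close>
  have minw: "E z powr s / s + C' * N z \<le> E w powr s / s + C' * N w"
    if w: "w \<in> edom q" "norm (w - y) \<le> \<eta> + 1" for w
  proof (cases "E w \<le> E y")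
    case True
    then have "(w, real_of_ereal (q w)) \<in> T"
      using w q_real[OF w(1)] by (simp add: T_def epi_def E_def dist_norm norm_minus_commute)
    from minE[OF this] show ?thesis by (simp add: E_def)
  next
    case False
    then have "e \<le> E w powr s / s"
      unfolding e_def using s E0[OF y] by (intro divide_right_mono powr_mono2) auto
    moreover have "C' * \<delta> \<le> C' * N w" using N_ge(2) C'0 by simp
    ultimately show ?thesis using min_y by linarith
  qed
  have "C' * N z \<le> C' * \<eta>"
  proof -
    have "0 \<le> E z powr s / s" using s by simp
    then have "C' * N z \<le> C' * m + C' * \<delta>" using min_y em by linarith
    then show ?thesis by (simp add: \<delta>_def algebra_simps)
  qed
  then have "N z \<le> \<eta>" using C' C'0 by simp
  then have z\<eta>: "norm (z - y) \<le> \<eta>" using N_ge(1)[of z] by linarith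
  have "E z = 0"
  proof (rule ccontr)
    assume "E z \<noteq> 0"
    with E0[OF z] have Ez: "E z > 0" by simp
    define K where "K = C' * E z powr \<theta>"
    \<comment> \<open>Concavity of \<open>t powr (1 - \<theta>)\<close> linearizes the optimality condition at \<open>z\<close>.\<close>
    have tangent: "E z - E w \<le> K * (N w - N z)" if w: "w \<in> edom q" "norm (w - z) < 1" for w
    proof -
      have "norm (w - y) \<le> \<eta> + 1"
        using norm_triangle_ineq[of "w - z" "z - y"] w z\<eta> by simp
      from minw[OF w(1) this]
      have "(E z powr s - E w powr s) / s \<le> C' * (N w - N z)"
        by (simp add: diff_divide_distrib algebra_simps)
      then have 1: "E z powr \<theta> * ((E z powr s - E w powr s) / s) \<le> K * (N w - N z)"
        unfolding K_def by (metis mult.assoc mult.commute mult_left_mono powr_ge_zero)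
      have "E w powr s * E z powr \<theta> \<le> s * E w + \<theta> * E z"
      proof (cases "E w = 0")
        case True
        then show ?thesis using s const Ez by simp
      next
        case False
        then have "E w > 0" using E0[OF w(1)] by simp
        then show ?thesis using Youngs_inequality_0[of s \<theta> "E w" "E z"] s const Ez by simp
      qed
      moreover have "E z powr s * E z powr \<theta> = E z"
        using Ez s by (simp add: powr_add[symmetric])
      moreover have "s * E z + \<theta> * E z = E z" using s by (simp add: distrib_right[symmetric])
      ultimately have "s * (E z - E w) \<le> E z powr \<theta> * (E z powr s - E w powr s)"
        by (simp add: algebra_simps)
      then have "E z - E w \<le> E z powr \<theta> * ((E z powr s - E w powr s) / s)"
        using s by (simp add: pos_le_divide_eq mult.commute)
      with 1 show ?thesis by linarith
    qed
    have "GDERIV N z :> (z - y) /\<^sub>R N z"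
    proof -
      have "GDERIV (\<lambda>w. \<delta>\<^sup>2 + (norm (w - y))\<^sup>2) z :> 2 *\<^sub>R (z - y)"
        using GDERIV_add[OF GDERIV_const GDERIV_square] by fastforce
      moreover have "DERIV sqrt (\<delta>\<^sup>2 + (norm (z - y))\<^sup>2) :> inverse (N z) / 2"
        using DERIV_real_sqrt[of "\<delta>\<^sup>2 + (norm (z - y))\<^sup>2"] N_pos[of z] by (simp add: N_def)
      ultimately have "GDERIV N z :> (inverse (N z) / 2) *\<^sub>R (2 *\<^sub>R (z - y))"
        unfolding N_def by (rule GDERIV_DERIV_compose)
      then show ?thesis by simp
    qed
    from GDERIV_mult[OF GDERIV_const[of K] this]
    have "GDERIV (\<lambda>w. K * N w) z :> K *\<^sub>R ((z - y) /\<^sub>R N z)" by simp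
    from GDERIV_diff[OF GDERIV_grad[OF g] this]
    have deriv: "GDERIV (\<lambda>w. g w - K * N w) z :> grad g z - K *\<^sub>R ((z - y) /\<^sub>R N z)" .
    have "grad g z - K *\<^sub>R ((z - y) /\<^sub>R N z) \<in> frechet_subdiff q z"
    proof (rule frechet_subdiffI[OF _ deriv])
      show "\<bar>q z\<bar> \<noteq> \<infinity>" using q_real[OF z] by (cases "q z") auto
      show "\<forall>\<^sub>F w in nhds z. q z + ereal (g w - K * N w - (g z - K * N z)) \<le> q w"
        unfolding eventually_nhds_metric
      proof (intro exI[of _ 1] conjI allI impI)
        fix w assume "dist w z < 1"
        then have "E z - E w \<le> K * (N w - N z)" if "w \<in> edom q"
          using tangent[OF that] by (simp add: dist_norm)
        moreover obtain t where "q z = ereal t" using q_real[OF z] by blast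
        ultimately show "q z + ereal (g w - K * N w - (g z - K * N z)) \<le> q w"
          using q[of w] by (cases "q w") (auto simp: E_def edom_def algebra_simps)
      qed simp
    qed
    from KL[OF z Ez _ this]
    have "E z \<le> E y \<Longrightarrow> C * E z powr \<theta> \<le> norm (K *\<^sub>R ((z - y) /\<^sub>R N z))"
      by simp
    moreover have "E z \<le> E y" using zr T_dom[OF zr] by (simp add: T_def E_def)
    moreover have "norm (K *\<^sub>R ((z - y) /\<^sub>R N z)) \<le> K"
    proof -
      have "K \<ge> 0" using C' C'0 by (simp add: K_def)
      moreover have "norm ((z - y) /\<^sub>R N z) \<le> 1"
        using N_ge(1)[of z] N_pos[of z] by (simp add: divide_simps)
      ultimately have "K * norm ((z - y) /\<^sub>R N z) \<le> K * 1" by (rule mult_left_mono[rotated])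
      then show ?thesis using \<open>K \<ge> 0\<close> by (simp only: norm_scaleR abs_of_nonneg mult_1_right)
    qed
    ultimately have "C * E z powr \<theta> \<le> C' * E z powr \<theta>" by (simp add: K_def)
    then show False using C' C'0 Ez by simp
  qed
  with z z\<eta> show ?thesis by blast
qed

section \<open>The maximum function under the standing assumption\<close>

locale KL_minimax =
  fixes f :: "'a::euclidean_space \<times> 'b::euclidean_space \<Rightarrow> real"
    and p :: "'a \<Rightarrow> ereal" and q :: "'b \<Rightarrow> ereal"
    and Lf Lg C \<theta> \<gamma> \<sigma> \<epsilon> :: real
  assumes f_smooth: "smooth_fun f"
    and f_Lipschitz: "\<forall>y \<in> edom q. Lf-lipschitz_on (edom p) (\<lambda>x. f (x, y))"
    and f_L_smooth: "Lg-lipschitz_on (edom p \<times> edom q) (grad f)"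
    and p: "proper_closed_convex p"
    and q: "proper_closed_convex q"
    and aff: "affine hull (edom p) = UNIV"
    and max_attained: "\<forall>x \<in> edom p. Ystar f q x \<noteq> {} \<and> \<bar>Fstar f q x\<bar> \<noteq> \<infinity>"
    and constants: "C > 0" "1 / 2 \<le> \<theta>" "\<theta> < 1" "\<gamma> > 0" "\<sigma> > 0"
    and KL: "\<forall>x \<in> edom p. \<forall>y \<in> KL_region f p q \<gamma> \<sigma> x.
               ereal C * epowr (Fstar f q x - Fval f q x y) \<theta> \<le> dist0 (partial_y_F f q x y)"
    and eps: "\<epsilon> > 0"
begin

text \<open>\<open>Q\<close> and \<open>Fr\<close> are the real-valued versions of \<open>q\<close> and \<open>F\<^sup>*\<close>; they agree with the originals
wherever those are finite, in particular on \<open>Y\<close> and on \<open>X\<close>.\<close>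

abbreviation "X \<equiv> edom p"
abbreviation "Y \<equiv> edom q"
abbreviation "U \<equiv> U_eps f p q \<epsilon>"
abbreviation "Q y \<equiv> real_of_ereal (q y)"
abbreviation "Fr x \<equiv> real_of_ereal (Fstar f q x)"
abbreviation "Ys x \<equiv> Ystar f q x"
abbreviation "grad_x x y \<equiv> fst (grad f (x, y))"
abbreviation "grad_y x y \<equiv> snd (grad f (x, y))"

text \<open>The right-hand side of the two gradient estimates, as a function of the distance of the points.\<close>

definition modulus :: "real \<Rightarrow> real" where
  "modulus t = Lg * t + inverse (1 - \<theta>) * C powr (- 1 / \<theta>) * Lg powr (1 / \<theta>) * t powr ((1 - \<theta>) / \<theta>)"

lemma f_diff: "f differentiable (at z)"
  using f_smooth unfolding smooth_fun_def by blast

lemma q_real: "y \<in> Y \<Longrightarrow> q y = ereal (Q y)"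
  by (rule proper_closed_convex_real[OF q])

lemma Fval_eq: "y \<in> Y \<Longrightarrow> Fval f q x y = ereal (f (x, y) - Q y)"
  unfolding Fval_def by (subst q_real) simp_all

lemma Fstar_eq: "x \<in> X \<Longrightarrow> Fstar f q x = ereal (Fr x)"
  using max_attained by (simp add: ereal_real)

lemma Fval_le_Fstar: "Fval f q x y \<le> Fstar f q x"
  unfolding Fstar_def by (rule SUP_upper) simp

lemma F_le: 
  assumes "\<bar>Fstar f q x\<bar> \<noteq> \<infinity>" "y \<in> Y" shows "f (x, y) - Q y \<le> Fr x"
  using Fval_le_Fstar[of x y] Fval_eq[OF assms(2), of x] assms(1)
  by (cases "Fstar f q x") auto

lemma F_le_X: "x \<in> X \<Longrightarrow> y \<in> Y \<Longrightarrow> f (x, y) - Q y \<le> Fr x"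
  by (rule F_le) (use max_attained in auto)

lemma Ystar_Y:
  assumes "x \<in> X" "y \<in> Ys x" shows "y \<in> Y"
proof -
  have "Fval f q x y = ereal (Fr x)" using assms Fstar_eq by (simp add: Ystar_def)
  then show ?thesis by (cases "q y") (auto simp: Fval_def edom_def)
qed

lemma Ystar_eq: "x \<in> X \<Longrightarrow> y \<in> Ys x \<Longrightarrow> f (x, y) - Q y = Fr x"
  using Fval_eq[OF Ystar_Y, of x y x] Fstar_eq[of x] by (simp add: Ystar_def)

lemma Ystar_I: "x \<in> X \<Longrightarrow> y \<in> Y \<Longrightarrow> f (x, y) - Q y = Fr x \<Longrightarrow> y \<in> Ys x"
  using Fval_eq[of y x] Fstar_eq[of x] by (simp add: Ystar_def)

lemma Ystar_ex: "x \<in> X \<Longrightarrow> \<exists>y. y \<in> Ys x"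
  using max_attained by blast

lemma Y_nonempty: "Y \<noteq> {}"
  using q by (auto simp: proper_closed_convex_def)

lemma Lf_nonneg: "0 \<le> Lf"
  using Y_nonempty f_Lipschitz lipschitz_on_nonneg by blast

lemma Lg_nonneg: "0 \<le> Lg"
  using f_L_smooth lipschitz_on_nonneg by blast

lemma f_Lip:
  assumes "x \<in> X" "x' \<in> X" "y \<in> Y" shows "f (x, y) - f (x', y) \<le> Lf * norm (x - x')"
proof -
  have "Lf-lipschitz_on X (\<lambda>x. f (x, y))" using f_Lipschitz assms by blast
  from lipschitz_onD[OF this assms(1,2)] show ?thesis by (simp add: dist_norm)
qed

lemma grad_Lip:
  assumes "x \<in> X" "x' \<in> X" "y \<in> Y" "y' \<in> Y"
  shows "norm (grad f (x, y) - grad f (x', y')) \<le> Lg * norm (x - x') + Lg * norm (y - y')"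
proof -
  have "norm (grad f (x, y) - grad f (x', y')) \<le> Lg * norm ((x, y) - (x', y'))"
    using lipschitz_onD[OF f_L_smooth, of "(x, y)" "(x', y')"] assms by (simp add: dist_norm)
  also have "\<dots> \<le> Lg * (norm (x - x') + norm (y - y'))"
    using Lg_nonneg norm_Pair_le[of "x - x'" "y - y'"] by (simp add: mult_left_mono)
  finally show ?thesis by (simp add: distrib_left)
qed

lemma grad_x_Lip:
  assumes "x \<in> X" "x' \<in> X" "y \<in> Y" "y' \<in> Y"
  shows "norm (grad_x x y - grad_x x' y') \<le> Lg * norm (x - x') + Lg * norm (y - y')"
  using norm_fst_le[of "fst (grad f (x, y) - grad f (x', y'))" "snd (grad f (x, y) - grad f (x', y'))"]
    grad_Lip[OF assms] unfolding prod.collapse by simp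

lemma grad_y_Lip:
  assumes "x \<in> X" "x' \<in> X" "y \<in> Y" "y' \<in> Y"
  shows "norm (grad_y x y - grad_y x' y') \<le> Lg * norm (x - x') + Lg * norm (y - y')"
  using norm_snd_le[where x = "fst (grad f (x, y) - grad f (x', y'))" and y = "snd (grad f (x, y) - grad f (x', y'))"]
    grad_Lip[OF assms] unfolding prod.collapse by simp

lemma Fstar_Lipschitz:
  assumes "x \<in> X" "x' \<in> X" shows "Fr x - Fr x' \<le> Lf * norm (x - x')"
proof -
  obtain y where y: "y \<in> Ys x" using Ystar_ex assms by blast
  then have "y \<in> Y" using Ystar_Y assms by blast
  with Ystar_eq[OF assms(1) y] F_le_X[OF assms(2), of y] f_Lip[OF assms, of y] show ?thesis by linarith
qed

text \<open>Moving the maximizer from \<open>x'\<close> to \<open>x\<close> costs one Lipschitz constant for \<open>F\<^sup>*\<close> and one for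
\<open>F(\<cdot>, y)\<close>; this is where the factor 2 in the radius comes from.\<close>

lemma suboptimality_le:
  assumes "x \<in> X" "x' \<in> X" "y \<in> Ys x'"
  shows "Fr x - (f (x, y) - Q y) \<le> 2 * Lf * norm (x - x')"
  using Fstar_Lipschitz[OF assms(1,2)] Ystar_eq[OF assms(2,3)] f_Lip[OF assms(2,1) Ystar_Y[OF assms(2,3)]]
  by (simp add: norm_minus_commute)

lemma grad_y_subgradient:
  assumes "x \<in> X" "y \<in> Ys x" shows "grad_y x y \<in> frechet_subdiff q y"
proof (rule frechet_subdiffI)
  show "GDERIV (\<lambda>v. f (x, v)) y :> grad_y x y" by (rule GDERIV_partial[OF f_diff])
  have y: "y \<in> Y" using Ystar_Y assms by blast
  then show "\<bar>q y\<bar> \<noteq> \<infinity>" using q_real[OF y] by (cases "q y") auto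
  show "\<forall>\<^sub>F z in nhds y. q y + ereal (f (x, z) - f (x, y)) \<le> q z"
  proof (rule always_eventually, rule allI)
    fix z
    show "q y + ereal (f (x, z) - f (x, y)) \<le> q z"
    proof (cases "z \<in> Y")
      case True
      from F_le_X[OF assms(1) True] Ystar_eq[OF assms] have "Q y + (f (x, z) - f (x, y)) \<le> Q z" by linarith
      then have "ereal (Q y + (f (x, z) - f (x, y))) \<le> ereal (Q z)" by simp
      then show ?thesis using q_real[OF True] q_real[OF y] by (metis plus_ereal.simps(1))
    qed (simp add: edom_def)
  qed
qed

lemma U_X: "x \<in> U \<Longrightarrow> x \<in> X" by (simp add: U_eps_def)

text \<open>On \<open>U\<^sub>\<epsilon>\<close> the level up to which the inequality holds is at least \<open>\<gamma> \<epsilon> powr \<sigma>\<close>, uniformly in the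
point.\<close>

lemma KL_real:
  assumes x: "x \<in> U" and y: "y \<in> Y" and E: "0 < Fr x - (f (x, y) - Q y)" "Fr x - (f (x, y) - Q y) \<le> \<gamma> * \<epsilon> powr \<sigma>"
    and u: "u \<in> frechet_subdiff q y"
  shows "C * (Fr x - (f (x, y) - Q y)) powr \<theta> \<le> norm (grad_y x y - u)"
proof -
  let ?D = "dist0 (limiting_subdiff (Psi f p q) x)"
  have xX: "x \<in> X" using x by (rule U_X)
  have E': "Fstar f q x - Fval f q x y = ereal (Fr x - (f (x, y) - Q y))"
    by (subst Fval_eq[OF y], subst Fstar_eq[OF xX]) simp
  have "ereal (\<gamma> * \<epsilon> powr \<sigma>) \<le> ereal \<gamma> * epowr ?D \<sigma>"
  proof -
    have gt: "ereal \<epsilon> < ?D" using x by (simp add: U_eps_def)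
    then show ?thesis
    proof (cases ?D)
      case (real d)
      then have "\<epsilon> powr \<sigma> \<le> d powr \<sigma>" using gt eps constants by (intro powr_mono2) auto
      then show ?thesis using real constants by (simp add: epowr_def)
    qed (use constants in \<open>auto simp: epowr_def\<close>)
  qed
  then have "y \<in> KL_region f p q \<gamma> \<sigma> x"
    using E order_trans[of "ereal (Fr x - (f (x, y) - Q y))" "ereal (\<gamma> * \<epsilon> powr \<sigma>)"] 
    unfolding KL_region_def mem_Collect_eq E' by simp
  then have "ereal C * epowr (Fstar f q x - Fval f q x y) \<theta> \<le> dist0 (partial_y_F f q x y)"
    using KL xX by blast
  also have "\<dots> \<le> ereal (norm (grad_y x y - u))"
  proof -
    have "grad_y x y - u \<in> partial_y_F f q x y"
      unfolding partial_y_F_def grad_eqI[OF GDERIV_partial(2)[OF f_diff]]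
      using u frechet_subset_limiting[of q y] by blast
    then show ?thesis unfolding dist0_def by (rule INF_lower)
  qed
  finally show ?thesis unfolding E' by (simp add: epowr_def)
qed

section \<open>Hoelder continuity of the maximizers\<close>

text \<open>The Kurdyka-Lojasiewicz inequality is used twice: at \<open>y\<close> itself, where near stationarity bounds
the suboptimality, and along the way to \<open>Y\<^sup>*(x)\<close>, where it yields the error bound. The two uses
contribute the powers \<open>(1 - \<theta>) / \<theta>\<close> and \<open>1\<close> of \<open>1 / C\<close>. The slack \<open>\<eta>\<close> stands in for the attainment of
the distance from \<open>Y\<^sup>*(x)\<close>.\<close>

lemma Ystar_Hoelder:
  assumes x: "x \<in> U" and x': "x' \<in> X" and close: "2 * Lf * norm (x - x') \<le> \<gamma> * \<epsilon> powr \<sigma>"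
    and y: "y \<in> Ys x'" and h: "\<eta> > 0"
  shows "\<exists>z \<in> Ys x. norm (z - y) \<le>
    inverse (1 - \<theta>) * C powr (- 1 / \<theta>) * (Lg * norm (x - x')) powr ((1 - \<theta>) / \<theta>) + \<eta>"
proof -
  have xX: "x \<in> X" using x by (rule U_X)
  have yY: "y \<in> Y" using Ystar_Y x' y by blast
  define E where "E z = Fr x - f (x, z) + Q z" for z
  define t where "t = Lg * norm (x - x')"
  have Ey: "E y \<le> \<gamma> * \<epsilon> powr \<sigma>" using suboptimality_le[OF xX x' y] close by (simp add: E_def)
  have E0: "0 \<le> E z" if "z \<in> Y" for z using F_le_X[OF xX that] by (simp add: E_def)
  have KLE: "C * E z powr \<theta> \<le> norm (grad_y x z - u)"
    if "z \<in> Y" "0 < E z" "E z \<le> \<gamma> * \<epsilon> powr \<sigma>" "u \<in> frechet_subdiff q z" for z u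
    using KL_real[OF x, of z u] that by (simp add: E_def algebra_simps)
  let ?B = "inverse (1 - \<theta>) * C powr (- 1 / \<theta>) * t powr ((1 - \<theta>) / \<theta>)"
  have "E y powr (1 - \<theta>) / ((1 - \<theta>) * C) \<le> ?B"
  proof (cases "E y = 0")
    case True
    then show ?thesis using constants by simp
  next
    case False
    then have pos: "0 < E y" using E0[OF yY] by simp
    have "norm (grad_y x y - grad_y x' y) \<le> t" using grad_y_Lip[OF xX x' yY yY] by (simp add: t_def)
    with KLE[OF yY pos Ey grad_y_subgradient[OF x' y]] have le: "C * E y powr \<theta> \<le> t" by simp
    then have t: "t > 0" using pos constants by (smt (verit) mult_pos_pos powr_gt_zero)
    have "E y powr \<theta> \<le> t / C" using le constants by (simp add: pos_le_divide_eq mult.commute)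
    then have "(E y powr \<theta>) powr ((1 - \<theta>) / \<theta>) \<le> (t / C) powr ((1 - \<theta>) / \<theta>)"
      using constants by (intro powr_mono2) auto
    then have "E y powr (1 - \<theta>) \<le> t powr ((1 - \<theta>) / \<theta>) / C powr ((1 - \<theta>) / \<theta>)"
      using constants t by (simp add: powr_powr powr_divide)
    then have "E y powr (1 - \<theta>) / ((1 - \<theta>) * C) \<le> t powr ((1 - \<theta>) / \<theta>) / C powr ((1 - \<theta>) / \<theta>) / ((1 - \<theta>) * C)"
      using constants by (intro divide_right_mono) auto
    also have "\<dots> = inverse (1 - \<theta>) * (1 / (C powr ((1 - \<theta>) / \<theta>) * C powr 1)) * t powr ((1 - \<theta>) / \<theta>)"
      using constants by (simp add: field_simps)
    also have "C powr ((1 - \<theta>) / \<theta>) * C powr 1 = C powr (1 / \<theta>)"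
      using constants by (simp only: powr_add[symmetric]) (simp add: field_simps)
    also have "1 / C powr (1 / \<theta>) = C powr (- 1 / \<theta>)"
      by (simp add: powr_minus_divide)
    finally show ?thesis .
  qed
  then have less: "E y powr (1 - \<theta>) / ((1 - \<theta>) * C) < ?B + \<eta>" using h by simp
  have "\<exists>z \<in> Y. Fr x - f (x, z) + Q z = 0 \<and> norm (z - y) \<le> ?B + \<eta>"
  proof (rule KL_error_bound[where q = q and g = "\<lambda>z. f (x, z)" and a = "Fr x"])
    show "closed (epi q)" "q z \<noteq> -\<infinity>" for z using q by (auto simp: proper_closed_convex_def)
    show "(\<lambda>z. f (x, z)) differentiable at z" for z
      by (rule GDERIV_differentiable[OF GDERIV_partial(2)[OF f_diff]])
    show "0 \<le> Fr x - f (x, z) + Q z" if "z \<in> Y" for z using E0[OF that] by (simp add: E_def)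
    show "C > 0" "0 < \<theta>" "\<theta> < 1" using constants by auto
    show "C * (Fr x - f (x, z) + Q z) powr \<theta> \<le> norm (grad (\<lambda>z. f (x, z)) z - u)"
      if "z \<in> Y" "0 < Fr x - f (x, z) + Q z" "Fr x - f (x, z) + Q z \<le> Fr x - f (x, y) + Q y"
        "u \<in> frechet_subdiff q z" for z u
      using KLE[of z u] that Ey grad_eqI[OF GDERIV_partial(2)[OF f_diff, of x z]] by (simp add: E_def)
    show "y \<in> Y" by (rule yY)
    show "(Fr x - f (x, y) + Q y) powr (1 - \<theta>) / ((1 - \<theta>) * C) < ?B + \<eta>" using less by (simp add: E_def)
  qed
  then obtain z where "z \<in> Y" "Fr x - f (x, z) + Q z = 0" "norm (z - y) \<le> ?B + \<eta>" by blast
  moreover from this have "z \<in> Ys x" by (intro Ystar_I[OF xX]) auto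
  ultimately show ?thesis unfolding t_def by blast
qed

lemma grad_x_near:
  assumes x: "x \<in> U" and x': "x' \<in> X" and close: "2 * Lf * norm (x - x') \<le> \<gamma> * \<epsilon> powr \<sigma>"
    and y: "y \<in> Ys x'" and h: "\<eta> > 0"
  shows "\<exists>z \<in> Ys x. norm (grad_x x z - grad_x x' y) \<le> modulus (norm (x - x')) + \<eta>"
proof -
  have xX: "x \<in> X" using x by (rule U_X)
  let ?B = "inverse (1 - \<theta>) * C powr (- 1 / \<theta>) * (Lg * norm (x - x')) powr ((1 - \<theta>) / \<theta>)"
  have pos: "\<eta> / (Lg + 1) > 0" using h Lg_nonneg by simp
  obtain z where z: "z \<in> Ys x" "norm (z - y) \<le> ?B + \<eta> / (Lg + 1)"
    using Ystar_Hoelder[OF x x' close y pos] by blast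
  have "norm (grad_x x z - grad_x x' y) \<le> Lg * norm (x - x') + Lg * norm (z - y)"
    using xX x' Ystar_Y[OF xX z(1)] Ystar_Y[OF x' y] by (rule grad_x_Lip)
  also have "\<dots> \<le> Lg * norm (x - x') + Lg * (?B + \<eta> / (Lg + 1))"
    using z(2) Lg_nonneg by (simp add: mult_left_mono)
  also have "\<dots> = Lg * norm (x - x') + Lg * ?B + Lg / (Lg + 1) * \<eta>"
    by (simp add: distrib_left)
  also have "\<dots> \<le> Lg * norm (x - x') + Lg * ?B + \<eta>"
  proof -
    have "Lg / (Lg + 1) \<le> 1" using Lg_nonneg by simp
    then have "Lg / (Lg + 1) * \<eta> \<le> 1 * \<eta>" using h by (intro mult_right_mono) auto
    then show ?thesis by simp
  qed
  also have "Lg * ?B = inverse (1 - \<theta>) * C powr (- 1 / \<theta>) * Lg powr (1 / \<theta>) * norm (x - x') powr ((1 - \<theta>) / \<theta>)"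
  proof -
    have "Lg powr 1 * Lg powr ((1 - \<theta>) / \<theta>) = Lg powr (1 / \<theta>)"
      using constants by (simp only: powr_add[symmetric]) (simp add: field_simps)
    then have "Lg * Lg powr ((1 - \<theta>) / \<theta>) = Lg powr (1 / \<theta>)" using Lg_nonneg by simp
    then show ?thesis using Lg_nonneg by (simp add: powr_mult mult_ac)
  qed
  finally show ?thesis using z(1) unfolding modulus_def by blast
qed

section \<open>Points of differentiability\<close>

lemma modulus_small:
  assumes "e > 0" shows "\<exists>d>0. \<forall>t. 0 \<le> t \<longrightarrow> t < d \<longrightarrow> modulus t < e"
proof -
  have "((\<lambda>t. t powr ((1 - \<theta>) / \<theta>)) \<longlongrightarrow> 0 powr ((1 - \<theta>) / \<theta>)) (at_right 0)"
  proof (rule tendsto_powr')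
    have "\<forall>\<^sub>F t in at_right (0::real). 0 \<le> t"
      using eventually_at_right_less[of "0::real"] by (rule eventually_mono) simp
    then show "(0::real) \<noteq> 0 \<or> 0 < (1 - \<theta>) / \<theta> \<and> (\<forall>\<^sub>F t in at_right (0::real). 0 \<le> t)"
      using constants by simp
  qed (auto intro: tendsto_ident_at)
  then have "((\<lambda>t. t powr ((1 - \<theta>) / \<theta>)) \<longlongrightarrow> 0) (at_right 0)" by simp
  then have "((\<lambda>t. Lg * t + inverse (1 - \<theta>) * C powr (- 1 / \<theta>) * Lg powr (1 / \<theta>) * t powr ((1 - \<theta>) / \<theta>))
      \<longlongrightarrow> Lg * 0 + inverse (1 - \<theta>) * C powr (- 1 / \<theta>) * Lg powr (1 / \<theta>) * 0) (at_right 0)"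
    by (intro tendsto_add tendsto_mult tendsto_const tendsto_ident_at)
  then have "(modulus \<longlongrightarrow> 0) (at_right 0)" unfolding modulus_def by simp
  then have "\<forall>\<^sub>F t in at_right 0. modulus t < e" using assms by (rule order_tendstoD)
  then obtain d where d: "d > 0" "\<And>t. 0 < t \<Longrightarrow> t < d \<Longrightarrow> modulus t < e"
    unfolding eventually_at_right[OF zero_less_one] by blast
  have "modulus 0 < e" using assms by (simp add: modulus_def)
  with d show ?thesis by (metis less_eq_real_def)
qed

lemma close_radius: "\<exists>r>0. \<forall>t. 0 \<le> t \<longrightarrow> t < r \<longrightarrow> 2 * Lf * t \<le> \<gamma> * \<epsilon> powr \<sigma>"
proof -
  let ?r = "\<gamma> * \<epsilon> powr \<sigma> / (2 * Lf + 1)"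
  have "2 * Lf * t \<le> \<gamma> * \<epsilon> powr \<sigma>" if "0 \<le> t" "t < ?r" for t
  proof -
    have "(2 * Lf + 1) * t \<le> \<gamma> * \<epsilon> powr \<sigma>"
      using that Lf_nonneg by (simp add: field_simps)
    then show ?thesis using that by (simp add: algebra_simps)
  qed
  moreover have "?r > 0" using constants eps Lf_nonneg by (intro divide_pos_pos mult_pos_pos) auto
  ultimately show ?thesis by blast
qed

lemma GDERIV_F: "GDERIV (\<lambda>u. f (u, y) - Q y) x :> grad_x x y"
  using GDERIV_diff[OF GDERIV_partial(1)[OF f_diff] GDERIV_const] by fastforce

text \<open>\<open>F(\<cdot>, y)\<close> touches \<open>F\<^sup>*\<close> from below at every point for which \<open>y\<close> is a maximizer.\<close>

lemma egrad_eq_grad_x: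
  assumes x: "x \<in> X" and d: "edifferentiable (Fstar f q) x" and y: "y \<in> Ys x"
  shows "egrad (Fstar f q) x = grad_x x y"
proof -
  have "GDERIV Fr x :> egrad (Fstar f q) x"
    unfolding egrad_def using d by (intro GDERIV_grad) (simp add: edifferentiable_def)
  moreover have "\<forall>\<^sub>F z in nhds x. f (z, y) - Q y \<le> Fr z"
  proof -
    have "\<forall>\<^sub>F z in nhds x. \<bar>Fstar f q z\<bar> \<noteq> \<infinity>" using d by (simp add: edifferentiable_def)
    then show ?thesis by (rule eventually_mono) (rule F_le[OF _ Ystar_Y[OF x y]])
  qed
  ultimately show ?thesis
    using GDERIV_eq_if_touching[OF GDERIV_F] Ystar_eq[OF x y] by metis
qed

lemma Fstar_finite_near:
  assumes "x \<in> interior X" shows "\<forall>\<^sub>F z in nhds x. \<bar>Fstar f q z\<bar> \<noteq> \<infinity>"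
proof -
  have "\<forall>\<^sub>F z in nhds x. z \<in> interior X"
    using assms by (intro eventually_nhds_in_open) auto
  then show ?thesis
  proof (rule eventually_mono)
    fix z assume "z \<in> interior X"
    then have "z \<in> X" using interior_subset by blast
    then show "\<bar>Fstar f q z\<bar> \<noteq> \<infinity>" using max_attained[rule_format, THEN conjunct2] by simp
  qed
qed

lemma edifferentiable_if_GDERIV:
  assumes "x \<in> interior X" "GDERIV Fr x :> v" shows "edifferentiable (Fstar f q) x"
  using Fstar_finite_near[OF assms(1)] GDERIV_differentiable[OF assms(2)]
  unfolding edifferentiable_def by blast

text \<open>At a point where a paraboloid touches \<open>F\<^sup>*\<close> from above, \<open>F(\<cdot>, y)\<close> touches it from below, and
\<open>F\<^sup>*\<close> is differentiable between the two.\<close>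

lemma edifferentiable_dense:
  assumes x: "x \<in> interior X" and r: "r > 0"
  shows "\<exists>z \<in> interior X. dist z x < r \<and> edifferentiable (Fstar f q) z"
proof -
  obtain s where s: "s > 0" "ball x s \<subseteq> interior X"
    using x open_contains_ball[of "interior X"] by auto
  define t where "t = min r s / 2"
  have t: "t > 0" "t < r" "cball x t \<subseteq> interior X"
    using r s by (auto simp: t_def subset_iff)
  have cont: "continuous_on (cball x t) Fr"
  proof -
    have "Lf-lipschitz_on (cball x t) Fr"
    proof (rule lipschitz_onI[OF _ Lf_nonneg])
      fix u v assume "u \<in> cball x t" "v \<in> cball x t"
      then have "u \<in> X" "v \<in> X" using t interior_subset by blast+
      then show "dist (Fr u) (Fr v) \<le> Lf * dist u v"
        using Fstar_Lipschitz[of u v] Fstar_Lipschitz[of v u]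
        by (simp add: dist_norm abs_le_iff norm_minus_commute)
    qed
    then show ?thesis by (rule lipschitz_on_continuous_on)
  qed
  obtain z M where z: "z \<in> ball x t"
    and M: "\<And>w. w \<in> ball x t \<Longrightarrow> Fr w \<le> Fr z + M * ((norm (w - x))\<^sup>2 - (norm (z - x))\<^sup>2)"
    using touched_by_paraboloid[OF cont t(1)] by blast
  have zi: "z \<in> interior X" using z t by auto
  then have zX: "z \<in> X" using interior_subset by blast
  obtain y where y: "y \<in> Ys z" using Ystar_ex zX by blast
  let ?u = "\<lambda>w. Fr z - M * (norm (z - x))\<^sup>2 + M * (norm (w - x))\<^sup>2"
  have u: "GDERIV ?u z :> 0 + M *\<^sub>R (2 *\<^sub>R (z - x))"
    using GDERIV_add[OF GDERIV_const GDERIV_mult[OF GDERIV_const[of M] GDERIV_square]] by simp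
  have low: "\<forall>\<^sub>F w in nhds z. f (w, y) - Q y \<le> Fr w"
    using Fstar_finite_near[OF zi] by (rule eventually_mono) (rule F_le[OF _ Ystar_Y[OF zX y]])
  have up: "\<forall>\<^sub>F w in nhds z. Fr w \<le> ?u w"
    unfolding eventually_nhds
    by (intro exI[of _ "ball x t"]) (use z M in \<open>auto simp: algebra_simps\<close>)
  have eq: "f (z, y) - Q y = Fr z" "?u z = Fr z" using Ystar_eq[OF zX y] by auto
  have "grad_x z y = 0 + M *\<^sub>R (2 *\<^sub>R (z - x))"
    by (rule GDERIV_eq_if_touching[OF GDERIV_F u])
      (use eq low up in \<open>auto elim: eventually_elim2\<close>)
  with u have "GDERIV ?u z :> grad_x z y" by simp
  from GDERIV_sandwich[OF GDERIV_F this eq low up]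
  have "edifferentiable (Fstar f q) z" by (rule edifferentiable_if_GDERIV[OF zi])
  moreover have "dist z x < r" using z t(2) by (simp add: dist_commute)
  ultimately show ?thesis using zi by blast
qed

lemma Psi_eq: "x \<in> X \<Longrightarrow> Psi f p q x = ereal (Fr x + real_of_ereal (p x))"
  using Fstar_eq[of x] proper_closed_convex_real[OF p, of x] unfolding Psi_def by (metis plus_ereal.simps(1))

text \<open>Three successive approximations: an interior point at which \<open>p\<close>, hence \<open>\<Psi>\<close>, has almost the
same value, a neighbourhood in which \<open>p\<close> stays close to that value by continuity, and a point of
differentiability in this neighbourhood. Nearness of \<open>\<Psi>\<close> puts that point into \<open>U\<^sub>\<epsilon>\<close>.\<close>

lemma edifferentiable_dense_U:
  assumes x: "x \<in> U" and r: "r > 0"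
  shows "\<exists>z \<in> U \<inter> interior X. dist z x < r \<and> edifferentiable (Fstar f q) z"
proof -
  let ?P = "\<lambda>x. real_of_ereal (p x)"
  have xX: "x \<in> X" using x by (rule U_X)
  obtain d where d: "d > 0"
    and stay: "\<And>z. dist z x < d \<Longrightarrow> \<bar>Psi f p q z - Psi f p q x\<bar> < ereal d \<Longrightarrow>
                 ereal \<epsilon> < dist0 (limiting_subdiff (Psi f p q) z)"
    using dist0_limiting_gt_nearby[of "Psi f p q" x \<epsilon>] x Psi_eq[OF xX] by (auto simp: U_eps_def)
  \<comment> \<open>Both \<open>p\<close> and the distance change by at most \<open>2 h\<close>, so \<open>\<Psi>\<close> changes by at most \<open>2 h (L\<^sub>f + 1) < d\<close>.\<close>
  define h where "h = Min {r, d, d / (Lf + 1)} / 4"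
  have h: "h > 0" "4 * h \<le> r" "4 * h \<le> d" "4 * h \<le> d / (Lf + 1)"
    using r d Lf_nonneg by (auto simp: h_def)
  obtain z1 where z1: "z1 \<in> interior X" "dist z1 x < h" "\<bar>?P z1 - ?P x\<bar> < h"
    using proper_closed_convex_interior_approx[OF p aff xX h(1)] by blast
  note con = proper_closed_convex_convex_on[OF p]
  have "convex_on (interior X) ?P"
    using convex_on_subset[OF con interior_subset] convex_interior[OF convex_on_imp_convex[OF con]] by blast
  then have "continuous_on (interior X) ?P" by (intro convex_on_continuous) auto
  then obtain s where s: "s > 0" "\<And>z. z \<in> interior X \<Longrightarrow> dist z z1 < s \<Longrightarrow> dist (?P z) (?P z1) < h"
    using z1 h unfolding continuous_on_iff by meson
  obtain z where z: "z \<in> interior X" "dist z z1 < min s h" "edifferentiable (Fstar f q) z"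
    using edifferentiable_dense[OF z1(1), of "min s h"] s h by auto
  have zX: "z \<in> X" using z interior_subset by blast
  have zx: "dist z x < 2 * h" using dist_triangle[of z x z1] z z1 by simp
  have "\<bar>?P z - ?P x\<bar> < 2 * h" using s(2)[OF z(1)] z(2) z1(3) by (simp add: dist_real_def)
  moreover have "\<bar>Fr z - Fr x\<bar> \<le> Lf * dist z x"
    using Fstar_Lipschitz[OF zX xX] Fstar_Lipschitz[OF xX zX]
    by (simp add: dist_norm abs_le_iff norm_minus_commute)
  moreover have "Lf * dist z x \<le> Lf * (2 * h)" using zx Lf_nonneg by (intro mult_left_mono) auto
  moreover have "(Lf + 1) * (4 * h) \<le> d" using h(4) Lf_nonneg by (simp add: field_simps)
  then have "4 * (Lf * h) + 4 * h \<le> d" by (simp add: algebra_simps)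
  moreover have "Lf * h \<ge> 0" using Lf_nonneg h by simp
  ultimately have "\<bar>(Fr z + ?P z) - (Fr x + ?P x)\<bar> < d" using h(1) by (simp add: abs_le_iff abs_less_iff)
  then have "\<bar>Psi f p q z - Psi f p q x\<bar> < ereal d"
    by (simp add: Psi_eq[OF zX] Psi_eq[OF xX])
  then have "z \<in> U" using stay[of z] zx h zX by (simp add: U_eps_def)
  then show ?thesis using z zx h by (intro bexI[of _ z]) auto
qed

section \<open>Independence of the maximizer and its consequences\<close>

text \<open>Approximate \<open>x\<close> by points \<open>z\<close> of differentiability in \<open>U\<^sub>\<epsilon>\<close>, and apply the estimate with the
roles exchanged: every maximizer for \<open>x\<close> is close to one for \<open>z\<close>, and all of those share the gradient
of \<open>F\<^sup>*\<close> at \<open>z\<close>.\<close>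

lemma grad_x_const:
  assumes x: "x \<in> U" and y: "y1 \<in> Ys x" "y2 \<in> Ys x"
  shows "grad_x x y1 = grad_x x y2"
proof -
  have xX: "x \<in> X" using x by (rule U_X)
  have "norm (grad_x x y1 - grad_x x y2) \<le> e" if e: "e > 0" for e
  proof -
    have e4: "e / 4 > 0" using e by simp
    obtain d where d: "d > 0" "\<And>t. 0 \<le> t \<Longrightarrow> t < d \<Longrightarrow> modulus t < e / 4" using modulus_small[OF e4] by blast
    obtain r where r: "r > 0" "\<And>t. 0 \<le> t \<Longrightarrow> t < r \<Longrightarrow> 2 * Lf * t \<le> \<gamma> * \<epsilon> powr \<sigma>"
      using close_radius by blast
    obtain z where z: "z \<in> U" "dist z x < min d r" "edifferentiable (Fstar f q) z"
      using edifferentiable_dense_U[OF x, of "min d r"] d r by auto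
    have zX: "z \<in> X" using z(1) by (rule U_X)
    have near: "norm (egrad (Fstar f q) z - grad_x x y) \<le> e / 2" if yx: "y \<in> Ys x" for y
    proof -
      have "2 * Lf * norm (z - x) \<le> \<gamma> * \<epsilon> powr \<sigma>" using r(2) z(2) by (simp add: dist_norm)
      from grad_x_near[OF z(1) xX this yx e4] obtain w
        where w: "w \<in> Ys z" "norm (grad_x z w - grad_x x y) \<le> modulus (norm (z - x)) + e / 4" by blast
      moreover have "modulus (norm (z - x)) < e / 4" using d(2) z(2) by (simp add: dist_norm)
      ultimately show ?thesis using egrad_eq_grad_x[OF zX z(3) w(1)] by simp
    qed
    show ?thesis
      using near[OF y(1)] near[OF y(2)] norm_triangle_ineq4[of "egrad (Fstar f q) z - grad_x x y2" "egrad (Fstar f q) z - grad_x x y1"]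
      by simp
  qed
  then have "norm (grad_x x y1 - grad_x x y2) \<le> 0" by (rule field_le_epsilon[of _ 0, simplified])
  then show ?thesis by simp
qed

lemma grad_x_Hoelder:
  assumes x: "x \<in> U" and x': "x' \<in> X" and close: "2 * Lf * norm (x - x') \<le> \<gamma> * \<epsilon> powr \<sigma>"
    and y: "y \<in> Ys x" and y': "y' \<in> Ys x'"
  shows "norm (grad_x x y - grad_x x' y') \<le> modulus (norm (x - x'))"
proof (rule field_le_epsilon)
  fix e :: real assume "0 < e"
  then obtain z where "z \<in> Ys x" and
    z: "norm (grad_x x z - grad_x x' y') \<le> modulus (norm (x - x')) + e"
    using grad_x_near[OF x x' close y'] by blast
  then have "grad_x x y = grad_x x z" by (intro grad_x_const[OF x y])
  with z show "norm (grad_x x y - grad_x x' y') \<le> modulus (norm (x - x')) + e" by simp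
qed

lemma f_increment_le:
  assumes seg: "ball x r \<subseteq> X" "z \<in> ball x r" and y: "y \<in> Y"
  shows "f (z, y) - f (x, y) \<le> (z - x) \<bullet> grad_x z y + Lg * norm (z - x) * norm (z - x)"
proof -
  define \<xi> where "\<xi> t = x + t *\<^sub>R (z - x)" for t :: real
  have deriv: "((\<lambda>t. f (\<xi> t, y)) has_derivative (\<lambda>s. (s *\<^sub>R (z - x)) \<bullet> grad_x (\<xi> t) y)) (at t within A)" for t A
  proof -
    have "(\<xi> has_derivative (\<lambda>s. s *\<^sub>R (z - x))) (at t within A)"
      unfolding \<xi>_def by (auto intro!: derivative_eq_intros)
    moreover have "((\<lambda>u. f (u, y)) has_derivative (\<lambda>h. h \<bullet> grad_x (\<xi> t) y)) (at (\<xi> t))"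
      using GDERIV_partial(1)[OF f_diff] by (simp add: gderiv_def)
    ultimately show ?thesis by (rule has_derivative_compose)
  qed
  from mvt_very_simple[of 0 1 "\<lambda>t. f (\<xi> t, y)", OF _ deriv]
  obtain t where t: "0 \<le> t" "t \<le> 1" and mvt: "f (z, y) - f (x, y) = (z - x) \<bullet> grad_x (\<xi> t) y"
    by (auto simp: \<xi>_def)
  have "dist x (\<xi> t) = t * dist x z" using t by (simp add: \<xi>_def dist_norm norm_minus_commute)
  also have "\<dots> \<le> dist x z" using t by (simp add: mult_left_le_one_le)
  finally have "\<xi> t \<in> X" using seg by auto
  moreover have zX: "z \<in> X" using seg by auto
  ultimately have "norm (grad_x (\<xi> t) y - grad_x z y) \<le> Lg * norm (\<xi> t - z)"
    using grad_x_Lip[OF _ _ y y, of "\<xi> t" z] by simp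
  also have "\<xi> t - z = - (1 - t) *\<^sub>R (z - x)" by (simp add: \<xi>_def algebra_simps)
  then have "norm (\<xi> t - z) \<le> norm (z - x)" using t by (simp add: mult_left_le_one_le)
  then have "Lg * norm (\<xi> t - z) \<le> Lg * norm (z - x)" using Lg_nonneg by (rule mult_left_mono)
  finally have "norm (grad_x (\<xi> t) y - grad_x z y) \<le> Lg * norm (z - x)" .
  then have "(z - x) \<bullet> (grad_x (\<xi> t) y - grad_x z y) \<le> norm (z - x) * (Lg * norm (z - x))"
    by (meson norm_cauchy_schwarz norm_ge_zero mult_left_mono order_trans)
  then show ?thesis unfolding mvt by (simp add: inner_diff_right mult_ac)
qed

text \<open>The lower expansion is that of \<open>F(\<cdot>, y)\<close>. For the upper one, the increment of \<open>F\<^sup>*\<close> is at most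
that of \<open>F(\<cdot>, y')\<close> with \<open>y'\<close> a maximizer for the moving point, whose slope is within the modulus of
\<open>\<nabla>\<^sub>x f(x, y)\<close>.\<close>

lemma Fstar_GDERIV:
  assumes x: "x \<in> U" "x \<in> interior X" and y: "y \<in> Ys x"
  shows "GDERIV Fr x :> grad_x x y"
  unfolding GDERIV_iff_error_bound
proof (intro allI impI)
  fix e :: real assume e: "e > 0"
  have xX: "x \<in> X" using x U_X by blast
  obtain r where r: "r > 0" "ball x r \<subseteq> X" using x(2) unfolding mem_interior by blast
  obtain d1 where d1: "d1 > 0" "\<And>t. 0 \<le> t \<Longrightarrow> t < d1 \<Longrightarrow> modulus t < e / 2" using modulus_small[of "e / 2"] e by auto
  obtain d2 where d2: "d2 > 0" "\<And>t. 0 \<le> t \<Longrightarrow> t < d2 \<Longrightarrow> 2 * Lf * t \<le> \<gamma> * \<epsilon> powr \<sigma>"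
    using close_radius by blast
  obtain d3 where d3: "d3 > 0" "\<And>z. norm (z - x) < d3 \<Longrightarrow>
      \<bar>(f (z, y) - Q y) - (f (x, y) - Q y) - (z - x) \<bullet> grad_x x y\<bar> \<le> e * norm (z - x)"
    using GDERIV_F[of y x] e unfolding GDERIV_iff_error_bound by blast
  define d where "d = Min {r, d1, d2, d3, e / (2 * (Lg + 1))}"
  have d: "d > 0" "d \<le> r" "d \<le> d1" "d \<le> d2" "d \<le> d3" "d \<le> e / (2 * (Lg + 1))"
    using r d1 d2 d3 e Lg_nonneg by (auto simp: d_def)
  have "\<bar>Fr z - Fr x - (z - x) \<bullet> grad_x x y\<bar> \<le> e * norm (z - x)" if z: "norm (z - x) < d" for z
  proof -
    have zb: "z \<in> ball x r" using z d by (simp add: dist_norm norm_minus_commute)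
    then have zX: "z \<in> X" using r by blast
    obtain y' where y': "y' \<in> Ys z" using Ystar_ex zX by blast
    have y'Y: "y' \<in> Y" using Ystar_Y zX y' by blast
    have "(f (x, y) - Q y) = Fr x" "f (z, y) - Q y \<le> Fr z"
      using Ystar_eq[OF xX y] F_le_X[OF zX Ystar_Y[OF xX y]] by auto
    then have low: "- (e * norm (z - x)) \<le> Fr z - Fr x - (z - x) \<bullet> grad_x x y"
      using d3(2)[of z] z d by (simp add: abs_le_iff)
    have "Fr z - Fr x \<le> f (z, y') - f (x, y')"
      using Ystar_eq[OF zX y'] F_le_X[OF xX y'Y] by linarith
    also have "\<dots> \<le> (z - x) \<bullet> grad_x z y' + Lg * norm (z - x) * norm (z - x)"
      by (rule f_increment_le[OF r(2) zb y'Y])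
    finally have 1: "Fr z - Fr x - (z - x) \<bullet> grad_x x y \<le> (z - x) \<bullet> (grad_x z y' - grad_x x y) + Lg * norm (z - x) * norm (z - x)"
      by (simp add: inner_diff_right)
    have "norm (grad_x x y - grad_x z y') \<le> modulus (norm (x - z))"
      using d2(2)[of "norm (x - z)"] z d by (intro grad_x_Hoelder[OF x(1) zX _ y y']) (simp add: norm_minus_commute)
    also have "\<dots> \<le> e / 2" using d1(2)[of "norm (x - z)"] z d by (simp add: norm_minus_commute less_imp_le)
    finally have "norm (grad_x z y' - grad_x x y) \<le> e / 2" by (simp add: norm_minus_commute)
    then have 2: "(z - x) \<bullet> (grad_x z y' - grad_x x y) \<le> norm (z - x) * (e / 2)"
      by (meson norm_cauchy_schwarz norm_ge_zero mult_left_mono order_trans)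
    have "(Lg + 1) * norm (z - x) \<le> e / 2"
    proof -
      have "norm (z - x) \<le> e / (2 * (Lg + 1))" using z d by simp
      then show ?thesis using Lg_nonneg by (simp add: field_simps)
    qed
    then have "Lg * norm (z - x) \<le> e / 2" by (simp add: distrib_right) (smt (verit) norm_ge_zero)
    then have 3: "Lg * norm (z - x) * norm (z - x) \<le> e / 2 * norm (z - x)" by (rule mult_right_mono) simp
    show ?thesis using low 1 2 3 by (simp add: abs_le_iff algebra_simps)
  qed
  then show "\<exists>d>0. \<forall>z. norm (z - x) < d \<longrightarrow> \<bar>Fr z - Fr x - (z - x) \<bullet> grad_x x y\<bar> \<le> e * norm (z - x)"
    using d(1) by blast
qed

text \<open>The gradients along the sequence are \<open>\<nabla>\<^sub>x f\<close> at maximizers, and the Hoelder estimate based at the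
limit point \<open>x \<in> U\<^sub>\<epsilon>\<close> controls them at all nearby points of the domain.\<close>

lemma egrad_tendsto:
  assumes x: "x \<in> U" and y: "y \<in> Ys x"
    and xs: "xs \<longlonglongrightarrow> x" "\<And>k. xs k \<in> X" "\<And>k. edifferentiable (Fstar f q) (xs k)"
  shows "(\<lambda>k. egrad (Fstar f q) (xs k)) \<longlonglongrightarrow> grad_x x y"
proof (rule tendstoI)
  fix e :: real assume e: "e > 0"
  obtain d1 where d1: "d1 > 0" "\<And>t. 0 \<le> t \<Longrightarrow> t < d1 \<Longrightarrow> modulus t < e" using modulus_small[OF e] by blast
  obtain d2 where d2: "d2 > 0" "\<And>t. 0 \<le> t \<Longrightarrow> t < d2 \<Longrightarrow> 2 * Lf * t \<le> \<gamma> * \<epsilon> powr \<sigma>"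
    using close_radius by blast
  have "\<forall>\<^sub>F k in sequentially. dist (xs k) x < min d1 d2"
    using xs(1) by (rule tendstoD) (use d1 d2 in simp)
  then show "\<forall>\<^sub>F k in sequentially. dist (egrad (Fstar f q) (xs k)) (grad_x x y) < e"
  proof eventually_elim
    case (elim k)
    obtain y' where y': "y' \<in> Ys (xs k)" using Ystar_ex xs by blast
    have k: "norm (x - xs k) < d1" "norm (x - xs k) < d2"
      using elim by (auto simp: dist_norm norm_minus_commute)
    have "norm (grad_x x y - grad_x (xs k) y') \<le> modulus (norm (x - xs k))"
      by (rule grad_x_Hoelder[OF x xs(2) _ y y']) (use d2(2) k in simp)
    also have "\<dots> < e" using d1(2) k by simp
    finally show ?case
      using egrad_eq_grad_x[OF xs(2) xs(3) y'] by (simp add: dist_norm norm_minus_commute)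
  qed
qed

lemma clarke_subdiff_eq:
  assumes x: "x \<in> U" and y: "y \<in> Ys x"
  shows "clarke_subdiff X (Fstar f q) x = {grad_x x y}"
proof -
  have "{v. \<exists>xs. (\<forall>k. xs k \<in> X \<and> edifferentiable (Fstar f q) (xs k)) \<and>
             xs \<longlonglongrightarrow> x \<and> (\<lambda>k. egrad (Fstar f q) (xs k)) \<longlonglongrightarrow> v} = {grad_x x y}" (is "?V = _")
  proof
    show "?V \<subseteq> {grad_x x y}" using egrad_tendsto[OF x y] LIMSEQ_unique by blast
    have "\<forall>k. \<exists>z. z \<in> X \<and> dist z x < 1 / real (Suc k) \<and> edifferentiable (Fstar f q) z"
    proof
      fix k
      obtain z where "z \<in> U" "dist z x < 1 / real (Suc k)" "edifferentiable (Fstar f q) z"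
        using edifferentiable_dense_U[OF x, of "1 / real (Suc k)"] by auto
      then show "\<exists>z. z \<in> X \<and> dist z x < 1 / real (Suc k) \<and> edifferentiable (Fstar f q) z"
        using U_X by blast
    qed
    then obtain zs where zs: "\<And>k. zs k \<in> X" "\<And>k. dist (zs k) x < 1 / real (Suc k)"
      "\<And>k. edifferentiable (Fstar f q) (zs k)" by metis
    have inv: "(\<lambda>k. 1 / real (Suc k)) \<longlonglongrightarrow> 0"
      using LIMSEQ_inverse_real_of_nat by (simp add: inverse_eq_divide)
    have "zs \<longlonglongrightarrow> x"
      by (rule metric_tendsto_imp_tendsto[OF inv], rule always_eventually, rule allI)
        (use zs(2) in \<open>simp add: dist_real_def less_imp_le\<close>)
    with egrad_tendsto[OF x y this zs(1,3)] zs(1,3) show "{grad_x x y} \<subseteq> ?V" by blast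
  qed
  then show ?thesis unfolding clarke_subdiff_def by simp
qed

lemma clarke_grad_eq: "x \<in> U \<Longrightarrow> y \<in> Ys x \<Longrightarrow> clarke_grad X (Fstar f q) x = grad_x x y"
  by (simp add: clarke_grad_def clarke_subdiff_eq)

lemma edifferentiable_U: "x \<in> U \<inter> interior X \<Longrightarrow> edifferentiable (Fstar f q) x"
  using Fstar_GDERIV edifferentiable_if_GDERIV Ystar_ex U_X by (metis IntE)

lemma clarke_grad_Hoelder:
  assumes x: "x \<in> U" "x' \<in> U" and close: "2 * Lf * norm (x - x') \<le> \<gamma> * \<epsilon> powr \<sigma>"
  shows "norm (clarke_grad X (Fstar f q) x - clarke_grad X (Fstar f q) x') \<le> modulus (norm (x - x'))"
proof -
  obtain y y' where "y \<in> Ys x" "y' \<in> Ys x'" using Ystar_ex U_X x by blast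
  then show ?thesis using grad_x_Hoelder[OF x(1) U_X[OF x(2)] close] clarke_grad_eq x by simp
qed

lemma egrad_eq_clarke_grad: "x \<in> U \<inter> interior X \<Longrightarrow> egrad (Fstar f q) x = clarke_grad X (Fstar f q) x"
  using egrad_eq_grad_x[OF U_X edifferentiable_U] clarke_grad_eq Ystar_ex U_X by (metis IntE)

text \<open>For \<open>L\<^sub>f = 0\<close> the radius is infinite and the conclusion trivial.\<close>

lemma radius_le:
  assumes "ereal t \<le> ereal (\<gamma> * \<epsilon> powr \<sigma>) / ereal (c * Lf)" "2 \<le> c" "0 \<le> t"
  shows "2 * Lf * t \<le> \<gamma> * \<epsilon> powr \<sigma>"
proof (cases "Lf = 0")
  case True
  then show ?thesis using constants by simp
next
  case False
  then have L: "Lf > 0" using Lf_nonneg by simp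
  then have "t \<le> \<gamma> * \<epsilon> powr \<sigma> / (c * Lf)" using assms by simp
  then have "c * Lf * t \<le> \<gamma> * \<epsilon> powr \<sigma>" using L assms(2) by (simp add: pos_le_divide_eq mult_ac)
  moreover have "2 * (Lf * t) \<le> c * (Lf * t)" using L assms by (intro mult_right_mono) auto
  ultimately show ?thesis by (simp add: mult_ac)
qed

end

theorem theorem1:
  fixes f :: "(real ^ 'n) \<times> (real ^ 'm) \<Rightarrow> real"
    and p :: "real ^ 'n \<Rightarrow> ereal"
    and q :: "real ^ 'm \<Rightarrow> ereal"
    and Lf Lg C \<theta> \<gamma> \<sigma> \<epsilon> :: real
  assumes f_smooth: "smooth_fun f"
    and f_Lipschitz: "\<forall>y \<in> edom q. Lf-lipschitz_on (edom p) (\<lambda>x. f (x, y))"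
    and f_L_smooth: "Lg-lipschitz_on (edom p \<times> edom q) (grad f)"
    and p: "proper_closed_convex p"
    and q: "proper_closed_convex q"
    and aff: "affine hull (edom p) = UNIV"
    and max_attained: "\<forall>x \<in> edom p. Ystar f q x \<noteq> {} \<and> \<bar>Fstar f q x\<bar> \<noteq> \<infinity>"
    and constants: "C > 0" "1 / 2 \<le> \<theta>" "\<theta> < 1" "\<gamma> > 0" "\<sigma> > 0"
    and KL: "\<forall>x \<in> edom p. \<forall>y \<in> KL_region f p q \<gamma> \<sigma> x.
               ereal C * epowr (Fstar f q x - Fval f q x y) \<theta> \<le> dist0 (partial_y_F f q x y)"
    and eps: "\<epsilon> > 0"
  shows
    "((\<forall>x \<in> U_eps f p q \<epsilon>. is_singleton (clarke_subdiff (edom p) (Fstar f q) x)) \<and>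
      (\<forall>x \<in> U_eps f p q \<epsilon> \<inter> interior (edom p). edifferentiable (Fstar f q) x))
   \<and> (\<forall>x \<in> U_eps f p q \<epsilon> \<inter> interior (edom p). \<forall>x' \<in> U_eps f p q \<epsilon> \<inter> interior (edom p).
        ereal (norm (x - x')) \<le> ereal (\<gamma> * \<epsilon> powr \<sigma>) / ereal (2 * Lf) \<longrightarrow>
        norm (egrad (Fstar f q) x - egrad (Fstar f q) x')
          \<le> Lg * norm (x - x')
            + inverse (1 - \<theta>) * C powr (- 1 / \<theta>) * Lg powr (1 / \<theta>)
              * norm (x - x') powr ((1 - \<theta>) / \<theta>))
   \<and> (\<forall>x \<in> U_eps f p q \<epsilon>. \<forall>x' \<in> U_eps f p q \<epsilon>.
        ereal (norm (x - x')) \<le> ereal (\<gamma> * \<epsilon> powr \<sigma>) / ereal (4 * Lf) \<longrightarrow>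
        norm (clarke_grad (edom p) (Fstar f q) x - clarke_grad (edom p) (Fstar f q) x')
          \<le> Lg * norm (x - x')
            + inverse (1 - \<theta>) * C powr (- 1 / \<theta>) * Lg powr (1 / \<theta>)
              * norm (x - x') powr ((1 - \<theta>) / \<theta>))
   \<and> (\<forall>x \<in> U_eps f p q \<epsilon>. \<forall>y \<in> Ystar f q x.
        clarke_grad (edom p) (Fstar f q) x = grad (\<lambda>u. f (u, y)) x)"
  (* Division by Lf is taken in ereal, so that the radius is infinite when Lf = 0. *)
proof -
  interpret KL_minimax f p q Lf Lg C \<theta> \<gamma> \<sigma> \<epsilon>
    by (rule KL_minimax.intro) (fact assms)+
  show ?thesis
  proof (intro conjI ballI impI)
    fix x assume "x \<in> U"
    moreover obtain y where "y \<in> Ys x" using Ystar_ex U_X calculation by blast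
    ultimately show "is_singleton (clarke_subdiff X (Fstar f q) x)" by (simp add: clarke_subdiff_eq)
  next
    fix x assume "x \<in> U \<inter> interior X"
    then show "edifferentiable (Fstar f q) x" by (rule edifferentiable_U)
  next
    fix x x' assume x: "x \<in> U \<inter> interior X" "x' \<in> U \<inter> interior X"
      and "ereal (norm (x - x')) \<le> ereal (\<gamma> * \<epsilon> powr \<sigma>) / ereal (2 * Lf)"
    then have "2 * Lf * norm (x - x') \<le> \<gamma> * \<epsilon> powr \<sigma>" by (intro radius_le[of _ 2]) auto
    with x show "norm (egrad (Fstar f q) x - egrad (Fstar f q) x') \<le> Lg * norm (x - x')
        + inverse (1 - \<theta>) * C powr (- 1 / \<theta>) * Lg powr (1 / \<theta>) * norm (x - x') powr ((1 - \<theta>) / \<theta>)"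
      using clarke_grad_Hoelder[of x x'] egrad_eq_clarke_grad unfolding modulus_def by simp
  next
    fix x x' assume x: "x \<in> U" "x' \<in> U"
      and "ereal (norm (x - x')) \<le> ereal (\<gamma> * \<epsilon> powr \<sigma>) / ereal (4 * Lf)"
    then have "2 * Lf * norm (x - x') \<le> \<gamma> * \<epsilon> powr \<sigma>" by (intro radius_le[of _ 4]) auto
    with x show "norm (clarke_grad X (Fstar f q) x - clarke_grad X (Fstar f q) x') \<le> Lg * norm (x - x')
        + inverse (1 - \<theta>) * C powr (- 1 / \<theta>) * Lg powr (1 / \<theta>) * norm (x - x') powr ((1 - \<theta>) / \<theta>)"
      using clarke_grad_Hoelder[of x x'] unfolding modulus_def by simp
  next
    fix x y assume "x \<in> U" "y \<in> Ys x"
    then show "clarke_grad X (Fstar f q) x = grad (\<lambda>u. f (u, y)) x"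
      by (simp add: clarke_grad_eq grad_eqI[OF GDERIV_partial(1)[OF f_diff]])
  qed
qed

end
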